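(* Let $T$ be a quasi-homogeneous operator. If there is a constant $K$ such that $\|p(T)\|_{\rm op}\le K\|p\|_{\infty,\mathbb D}$ for all $p\in\mathbb C[z]$, then $T$ is similar to a contraction.
   Context: $\mathbb D$ is the open unit disc and $\|p\|_{\infty,\mathbb D}=\sup_{z\in\mathbb D}|p(z)|$. For $\lambda>0$, $\mathbb A^{(\lambda)}(\mathbb D)$ is the Hilbert space of holomorphic functions on $\mathbb D$ with reproducing kernel $(1-z\bar w)^{-\lambda}$. $B_n(\mathbb D)$ is the Cowen–Douglas class: bounded operators $T$ on a separable Hilbert space such that for each $w\in\mathbb D$, $T-w$ is surjective and $\dim\ker(T-w)=n$, and the subspaces $\ker(T-w)$ span a dense subspace. A quasi-homogeneous holomorphic curve $t$ of rank $n\ge2$ is given by: $\lambda_0>0$, a valency $\Lambda(t)>0$, $\lambda_i=\lambda_0+i\Lambda(t)$, and complex constants $\mu_{i,j}$ ($0\le i\le j\le n-1$) with $\mu_{i,i}=1$ and $\mu_{i,i+1}\ne0$. Put $\mathcal H_i=\mathbb A^{(\lambda_i)}(\mathbb D)$, $\mathcal H=\mathcal H_0\oplus\cdots\oplus\mathcal H_{n-1}$, atoms $t_i(w)(z)=(1-zw)^{-\lambda_i}\in\mathcal H_i$, frame $\gamma_j(w)=\sum_{i=0}^j\mu_{i,j}t_i^{(j-i)}(w)$ (derivatives in $w$), and $t(w)=\mathrm{span}\{\gamma_0(w),\dots,\gamma_{n-1}(w)\}$. Standing assumption: the linear transformation $T$ with $T\gamma_j(w)=w\gamma_j(w)$ extends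 to a bounded operator on $\mathcal H$ belonging to $B_n(\mathbb D)$; such an operator $T$ (up to unitary equivalence) is called quasi-homogeneous. $T$ is similar to a contraction if $T=LCL^{-1}$ for some bounded invertible operator $L$ and some operator $C$ with $\|C\|\le1$. *)

theory Defs
  imports
    "HOL-Analysis.Analysis"
    "HOL-Library.Function_Algebras"
    "HOL-Computational_Algebra.Polynomial"
begin

section \<open>Complex Hilbert spaces\<close>

class complex_vector = ab_group_add +
  fixes scaleC :: "complex \<Rightarrow> 'a \<Rightarrow> 'a"  (infixr "*\<^sub>C" 75)
  assumes scaleC_add_right: "a *\<^sub>C (x + y) = a *\<^sub>C x + a *\<^sub>C y"
    and scaleC_add_left: "(a + b) *\<^sub>C x = a *\<^sub>C x + b *\<^sub>C x"
    and scaleC_scaleC: "a *\<^sub>C (b *\<^sub>C x) = (a * b) *\<^sub>C x"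
    and scaleC_one: "1 *\<^sub>C x = x"

global_interpretation complex_vector:
  vector_space "scaleC :: complex \<Rightarrow> 'a \<Rightarrow> 'a :: complex_vector"
  by unfold_locales (rule scaleC_add_right scaleC_add_left scaleC_scaleC scaleC_one)+

instantiation complex :: complex_vector
begin
definition scaleC_complex_def: "(a::complex) *\<^sub>C (x::complex) = a * x"
instance
  by standard (simp_all add: scaleC_complex_def algebra_simps)
end

instantiation "fun" :: (type, complex_vector) complex_vector
begin
definition scaleC_fun_def: "a *\<^sub>C f = (\<lambda>x. a *\<^sub>C f x)"
instance
  by standard
    (simp_all add: scaleC_fun_def plus_fun_def scaleC_add_right scaleC_add_left
      scaleC_scaleC scaleC_one)
end

text \<open>
  A Hilbert space is given by a carrier inside an ambient complex vector space and an inner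
  product, linear in the first and conjugate-linear in the second argument.  Values of the
  inner product and of operators outside the carrier are irrelevant.
\<close>

record 'a hspace =
  carr :: "'a set"
  ip :: "'a \<Rightarrow> 'a \<Rightarrow> complex"

definition hnorm :: "'a hspace \<Rightarrow> 'a \<Rightarrow> real" where
  "hnorm H x = sqrt (Re (ip H x x))"

text \<open>
  The distance is set to 0 off the carrier because the locale \<^locale>\<open>Metric_space\<close> demands
  symmetry and nonnegativity on the whole type.
\<close>

definition hdist :: "'a::complex_vector hspace \<Rightarrow> 'a \<Rightarrow> 'a \<Rightarrow> real" where
  "hdist H x y = (if x \<in> carr H \<and> y \<in> carr H then hnorm H (x - y) else 0)"

definition inner_product_space :: "'a::complex_vector hspace \<Rightarrow> bool" where
  "inner_product_space H \<longleftrightarrow>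
     complex_vector.subspace (carr H) \<and>
     (\<forall>x\<in>carr H. \<forall>y\<in>carr H. \<forall>z\<in>carr H. ip H (x + y) z = ip H x z + ip H y z) \<and>
     (\<forall>c. \<forall>x\<in>carr H. \<forall>y\<in>carr H. ip H (c *\<^sub>C x) y = c * ip H x y) \<and>
     (\<forall>x\<in>carr H. \<forall>y\<in>carr H. ip H y x = cnj (ip H x y)) \<and>
     (\<forall>x\<in>carr H. x \<noteq> 0 \<longrightarrow> 0 < Re (ip H x x))"

definition hilbert_space :: "'a::complex_vector hspace \<Rightarrow> bool" where
  "hilbert_space H \<longleftrightarrow>
     inner_product_space H \<and> Metric_space.mcomplete (carr H) (hdist H)"

definition dense_in_space :: "'a::complex_vector hspace \<Rightarrow> 'a set \<Rightarrow> bool" where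
  "dense_in_space H S \<longleftrightarrow>
     S \<subseteq> carr H \<and> (Metric_space.mtopology (carr H) (hdist H)) closure_of S = carr H"

definition separable :: "'a::complex_vector hspace \<Rightarrow> bool" where
  "separable H \<longleftrightarrow> (\<exists>S. countable S \<and> dense_in_space H S)"

lemma inner_product_spaceD:
  assumes "inner_product_space H"
  shows "complex_vector.subspace (carr H)"
    and "\<And>x y z. x \<in> carr H \<Longrightarrow> y \<in> carr H \<Longrightarrow> z \<in> carr H \<Longrightarrow>
      ip H (x + y) z = ip H x z + ip H y z"
    and "\<And>c x y. x \<in> carr H \<Longrightarrow> y \<in> carr H \<Longrightarrow> ip H (c *\<^sub>C x) y = c * ip H x y"
    and "\<And>x y. x \<in> carr H \<Longrightarrow> y \<in> carr H \<Longrightarrow> ip H y x = cnj (ip H x y)"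
    and "\<And>x. x \<in> carr H \<Longrightarrow> x \<noteq> 0 \<Longrightarrow> 0 < Re (ip H x x)"
proof -
  note H = assms[unfolded inner_product_space_def]
  note H2 = H[THEN conjunct2] and H3 = H[THEN conjunct2, THEN conjunct2]
  note H4 = H3[THEN conjunct2]
  show "complex_vector.subspace (carr H)" by (rule H[THEN conjunct1])
  show "\<And>x y z. x \<in> carr H \<Longrightarrow> y \<in> carr H \<Longrightarrow> z \<in> carr H \<Longrightarrow>
      ip H (x + y) z = ip H x z + ip H y z"
    by (rule H2[THEN conjunct1, rule_format])
  show "\<And>c x y. x \<in> carr H \<Longrightarrow> y \<in> carr H \<Longrightarrow> ip H (c *\<^sub>C x) y = c * ip H x y"
    by (rule H3[THEN conjunct1, rule_format])
  show "\<And>x y. x \<in> carr H \<Longrightarrow> y \<in> carr H \<Longrightarrow> ip H y x = cnj (ip H x y)"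
    by (rule H4[THEN conjunct1, rule_format])
  show "\<And>x. x \<in> carr H \<Longrightarrow> x \<noteq> 0 \<Longrightarrow> 0 < Re (ip H x x)"
    by (rule H4[THEN conjunct2, rule_format])
qed

lemma inner_product_space_norm_triangle:
  assumes H: "inner_product_space H" and x: "x \<in> carr H" and y: "y \<in> carr H"
  shows "hnorm H (x + y) \<le> hnorm H x + hnorm H y"
proof -
  note sub = inner_product_spaceD(1)[OF H] and add = inner_product_spaceD(2)[OF H]
    and scale = inner_product_spaceD(3)[OF H] and sym = inner_product_spaceD(4)[OF H]
    and pos = inner_product_spaceD(5)[OF H]
  have memA: "a + b \<in> carr H" if "a \<in> carr H" "b \<in> carr H" for a b
    using sub that by (rule complex_vector.subspace_add)
  have memS: "k *\<^sub>C a \<in> carr H" if "a \<in> carr H" for a k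
    using sub that by (rule complex_vector.subspace_scale)
  note mem = memA memS
  have zero: "ip H 0 0 = 0"
    using scale[of 0 0 0] complex_vector.subspace_0[OF sub] by simp
  have nonneg: "0 \<le> Re (ip H a a)" if "a \<in> carr H" for a
    using pos[OF that] zero by (cases "a = 0") auto
  have addr: "ip H a (b + c) = ip H a b + ip H a c"
    if "a \<in> carr H" "b \<in> carr H" "c \<in> carr H" for a b c
    using that add[of b c a] sym[of "b + c" a] sym[of b a] sym[of c a] memA[of b c]
    by (metis complex_cnj_add)
  have scaler: "ip H a (k *\<^sub>C b) = cnj k * ip H a b"
    if "a \<in> carr H" "b \<in> carr H" for a b k
    using that scale[of b a k] sym[of "k *\<^sub>C b" a] sym[of b a] memS[of b k]
    by (metis complex_cnj_mult)
  define A B R where "A = Re (ip H x x)" and "B = Re (ip H y y)" and "R = Re (ip H x y)"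
  have Ryx: "Re (ip H y x) = R"
    unfolding R_def sym[OF x y] by simp
  have quad: "0 \<le> s\<^sup>2 * A + 2 * s * t * R + t\<^sup>2 * B" for s t :: real
  proof -
    have "0 \<le> Re (ip H (of_real s *\<^sub>C x + of_real t *\<^sub>C y) (of_real s *\<^sub>C x + of_real t *\<^sub>C y))"
      using nonneg mem x y by blast
    also have "\<dots> = s\<^sup>2 * A + 2 * s * t * R + t\<^sup>2 * B"
      using x y Ryx
      by (simp add: add addr scale scaler mem A_def B_def R_def power2_eq_square algebra_simps)
    finally show ?thesis .
  qed
  have A: "0 \<le> A" and B: "0 \<le> B"
    unfolding A_def B_def using nonneg[OF x] nonneg[OF y] by simp_all
  have "R \<le> sqrt A * sqrt B"
  proof (cases "A = 0 \<or> B = 0")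
    case True
    then have "x = 0 \<or> y = 0"
      using pos x y unfolding A_def B_def by force
    then have "R = 0"
      using scale[of x x 0] scale[of x y 0] scaler[of x y 0] x y scale[of y y 0] by (auto simp: R_def)
    then show ?thesis using A B by simp
  next
    case False
    have "0 \<le> 2 * (sqrt A * sqrt B) * (sqrt A * sqrt B - R)"
      using quad[of "sqrt B" "- sqrt A"] A B by (simp add: algebra_simps)
    moreover have "0 < sqrt A * sqrt B" using False A B by simp
    ultimately show ?thesis by (simp add: zero_le_mult_iff)
  qed
  then have "A + 2 * R + B \<le> (sqrt A + sqrt B)\<^sup>2"
    using A B by (simp add: power2_sum)
  moreover have "Re (ip H (x + y) (x + y)) = A + 2 * R + B"
    using x y Ryx by (simp add: add addr mem A_def B_def R_def)
  ultimately show ?thesis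
    using A B by (simp add: hnorm_def A_def B_def real_le_lsqrt)
qed

lemma inner_product_space_Metric_space:
  assumes H: "inner_product_space H"
  shows "Metric_space (carr H) (hdist H)"
proof -
  note sub = inner_product_spaceD(1)[OF H] and scale = inner_product_spaceD(3)[OF H]
    and sym = inner_product_spaceD(4)[OF H] and pos = inner_product_spaceD(5)[OF H]
  have diff: "a - b \<in> carr H" if "a \<in> carr H" "b \<in> carr H" for a b
    using sub that by (rule complex_vector.subspace_diff)
  have zero: "ip H 0 0 = 0"
    using scale[of 0 0 0] complex_vector.subspace_0[OF sub] by simp
  have nonneg: "0 \<le> Re (ip H a a)" if "a \<in> carr H" for a
    using pos[OF that] zero by (cases "a = 0") auto
  have minus: "hnorm H (- a) = hnorm H a" if a: "a \<in> carr H" for a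
  proof -
    have eq: "- a = (- 1) *\<^sub>C a" by simp
    have ma: "- a \<in> carr H" using sub a by (rule complex_vector.subspace_neg)
    have "ip H (- a) (- a) = - ip H a (- a)"
      using scale[OF a ma, of "- 1"] by simp
    also have "ip H a (- a) = - ip H a a"
      using sym[OF ma a] scale[OF a a, of "- 1"] sym[OF a a]
      by (metis eq complex_cnj_minus mult_minus1)
    finally show ?thesis by (simp add: hnorm_def)
  qed
  show ?thesis
  proof
    show "0 \<le> hdist H x y" for x y
      using nonneg diff by (simp add: hdist_def hnorm_def)
    show "hdist H x y = hdist H y x" for x y
      using minus[of "x - y"] diff by (simp add: hdist_def)
    show "hdist H x y = 0 \<longleftrightarrow> x = y" if "x \<in> carr H" "y \<in> carr H" for x y
      using that pos[of "x - y"] diff zero by (force simp: hdist_def hnorm_def)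
    show "hdist H x z \<le> hdist H x y + hdist H y z"
      if "x \<in> carr H" "y \<in> carr H" "z \<in> carr H" for x y z
      using inner_product_space_norm_triangle[OF H, of "x - y" "y - z"] that diff
      by (simp add: hdist_def)
  qed
qed

section \<open>Operators\<close>

definition linear_op ::
  "'a::complex_vector hspace \<Rightarrow> 'b::complex_vector hspace \<Rightarrow> ('a \<Rightarrow> 'b) \<Rightarrow> bool" where
  "linear_op H K A \<longleftrightarrow>
     A \<in> carr H \<rightarrow> carr K \<and>
     (\<forall>x\<in>carr H. \<forall>y\<in>carr H. A (x + y) = A x + A y) \<and>
     (\<forall>c. \<forall>x\<in>carr H. A (c *\<^sub>C x) = c *\<^sub>C A x)"

definition bounded_op ::
  "'a::complex_vector hspace \<Rightarrow> 'b::complex_vector hspace \<Rightarrow> ('a \<Rightarrow> 'b) \<Rightarrow> bool" where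
  "bounded_op H K A \<longleftrightarrow>
     linear_op H K A \<and> (\<exists>B. \<forall>x\<in>carr H. hnorm K (A x) \<le> B * hnorm H x)"

definition op_norm :: "'a::complex_vector hspace \<Rightarrow> ('a \<Rightarrow> 'a) \<Rightarrow> real" where
  "op_norm H A = (SUP x\<in>{x \<in> carr H. hnorm H x \<le> 1}. hnorm H (A x))"

definition unitary ::
  "'a::complex_vector hspace \<Rightarrow> 'b::complex_vector hspace \<Rightarrow> ('a \<Rightarrow> 'b) \<Rightarrow> bool" where
  "unitary H K U \<longleftrightarrow>
     linear_op H K U \<and> bij_betw U (carr H) (carr K) \<and>
     (\<forall>x\<in>carr H. \<forall>y\<in>carr H. ip K (U x) (U y) = ip H x y)"

definition unitarily_equivalent ::
  "'a::complex_vector hspace \<Rightarrow> ('a \<Rightarrow> 'a) \<Rightarrow> 'b::complex_vector hspace \<Rightarrow> ('b \<Rightarrow> 'b) \<Rightarrow> bool"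
  where
  "unitarily_equivalent H S K T \<longleftrightarrow>
     (\<exists>U. unitary H K U \<and> (\<forall>x\<in>carr H. U (S x) = T (U x)))"

definition similar_to_contraction :: "'a::complex_vector hspace \<Rightarrow> ('a \<Rightarrow> 'a) \<Rightarrow> bool" where
  "similar_to_contraction H T \<longleftrightarrow>
     (\<exists>L L' C.
        bounded_op H H L \<and> bounded_op H H L' \<and>
        (\<forall>x\<in>carr H. L' (L x) = x \<and> L (L' x) = x) \<and>
        bounded_op H H C \<and> op_norm H C \<le> 1 \<and>
        (\<forall>x\<in>carr H. T x = L (C (L' x))))"

definition poly_op :: "complex poly \<Rightarrow> ('a \<Rightarrow> 'a) \<Rightarrow> 'a \<Rightarrow> 'a::complex_vector" where
  "poly_op p T x = (\<Sum>k\<le>degree p. coeff p k *\<^sub>C (T ^^ k) x)"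

definition disc_norm :: "complex poly \<Rightarrow> real" where
  "disc_norm p = (SUP z\<in>ball 0 1. cmod (poly p z))"

definition eigenspace_at ::
  "'a::complex_vector hspace \<Rightarrow> ('a \<Rightarrow> 'a) \<Rightarrow> complex \<Rightarrow> 'a set" where
  "eigenspace_at H T w = {x \<in> carr H. T x - w *\<^sub>C x = 0}"

text \<open>
  The condition \<open>0 < n\<close> also guards against the library convention that an
  infinite-dimensional space has \<open>dim\<close> equal to 0.
\<close>

definition Cowen_Douglas :: "nat \<Rightarrow> 'a::complex_vector hspace \<Rightarrow> ('a \<Rightarrow> 'a) \<Rightarrow> bool" where
  "Cowen_Douglas n H T \<longleftrightarrow>
     0 < n \<and> hilbert_space H \<and> separable H \<and> bounded_op H H T \<and>
     (\<forall>w\<in>ball 0 1.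
        (\<lambda>x. T x - w *\<^sub>C x) ` carr H = carr H \<and>
        complex_vector.dim (eigenspace_at H T w) = n) \<and>
     dense_in_space H (complex_vector.span (\<Union>w\<in>ball 0 1. eigenspace_at H T w))"

section \<open>The spaces of holomorphic functions\<close>

text \<open>
  A function on the disc is represented by a total function vanishing off the disc, so that
  equality of functions is equality on the disc.
\<close>

definition on_disc :: "(complex \<Rightarrow> complex) \<Rightarrow> complex \<Rightarrow> complex" where
  "on_disc f z = (if z \<in> ball 0 1 then f z else 0)"

text \<open>
  The reproducing kernel determines the space together with its inner product, so for each
  \<open>\<alpha> > 0\<close> the following predicate describes exactly one Hilbert space.  The power is the principal
  branch; its base has positive real part.
\<close>

definition is_weighted_bergman :: "real \<Rightarrow> (complex \<Rightarrow> complex) hspace \<Rightarrow> bool" where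
  "is_weighted_bergman \<alpha> H \<longleftrightarrow>
     hilbert_space H \<and>
     (\<forall>f\<in>carr H. f holomorphic_on ball 0 1 \<and> on_disc f = f) \<and>
     (\<forall>w\<in>ball 0 1.
        on_disc (\<lambda>z. (1 - z * cnj w) powr (- of_real \<alpha>)) \<in> carr H \<and>
        (\<forall>f\<in>carr H. ip H f (on_disc (\<lambda>z. (1 - z * cnj w) powr (- of_real \<alpha>))) = f w))"

definition direct_sum :: "nat \<Rightarrow> (nat \<Rightarrow> 'a::complex_vector hspace) \<Rightarrow> (nat \<Rightarrow> 'a) hspace" where
  "direct_sum n \<H> =
     \<lparr>carr = {f. (\<forall>i<n. f i \<in> carr (\<H> i)) \<and> (\<forall>i\<ge>n. f i = 0)},
      ip = (\<lambda>f g. \<Sum>i<n. ip (\<H> i) (f i) (g i))\<rparr>"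

definition embed :: "nat \<Rightarrow> 'a::zero \<Rightarrow> nat \<Rightarrow> 'a" where
  "embed i x = (\<lambda>k. if k = i then x else 0)"

section \<open>Quasi-homogeneous operators\<close>

text \<open>
  \<open>atom_deriv \<alpha> k w\<close> is the \<open>k\<close>-th derivative at \<open>w\<close> of the curve of functions
  \<open>v \<mapsto> (z \<mapsto> (1 - z * v) powr (- \<alpha>))\<close>, taken for each fixed \<open>z\<close>.  The curve is
  holomorphic into the Hilbert space, where evaluations are continuous, so this is also its
  derivative in norm.
\<close>

definition atom_deriv :: "real \<Rightarrow> nat \<Rightarrow> complex \<Rightarrow> complex \<Rightarrow> complex" where
  "atom_deriv \<alpha> k w = on_disc (\<lambda>z. (deriv ^^ k) (\<lambda>v. (1 - z * v) powr (- of_real \<alpha>)) w)"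

definition frame ::
  "(nat \<Rightarrow> real) \<Rightarrow> (nat \<Rightarrow> nat \<Rightarrow> complex) \<Rightarrow> nat \<Rightarrow> complex \<Rightarrow> nat \<Rightarrow> complex \<Rightarrow> complex" where
  "frame \<alpha> \<mu> j w = (\<Sum>i\<le>j. embed i (\<mu> i j *\<^sub>C atom_deriv (\<alpha> i) (j - i) w))"

text \<open>
  The vectors \<open>frame \<alpha> \<mu> j w\<close> span a dense subspace, so the bounded operator \<open>T\<close> below is the
  unique bounded extension of the linear transformation prescribed on the frame.
  Only the entries \<open>\<mu> i j\<close> with \<open>i \<le> j < n\<close> matter.
\<close>

definition model_operator ::
  "nat \<Rightarrow> real \<Rightarrow> real \<Rightarrow> (nat \<Rightarrow> nat \<Rightarrow> complex) \<Rightarrow> (nat \<Rightarrow> (complex \<Rightarrow> complex) hspace) \<Rightarrow>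
   ((nat \<Rightarrow> complex \<Rightarrow> complex) \<Rightarrow> (nat \<Rightarrow> complex \<Rightarrow> complex)) \<Rightarrow> bool" where
  "model_operator n \<alpha>\<^sub>0 \<Lambda> \<mu> \<H> T \<longleftrightarrow>
     2 \<le> n \<and> 0 < \<alpha>\<^sub>0 \<and> 0 < \<Lambda> \<and>
     (\<forall>i<n. \<mu> i i = 1) \<and> (\<forall>i. i + 1 < n \<longrightarrow> \<mu> i (i + 1) \<noteq> 0) \<and>
     (\<forall>i<n. is_weighted_bergman (\<alpha>\<^sub>0 + of_nat i * \<Lambda>) (\<H> i)) \<and>
     (\<forall>w\<in>ball 0 1. \<forall>j<n.
        T (frame (\<lambda>i. \<alpha>\<^sub>0 + of_nat i * \<Lambda>) \<mu> j w) =
          w *\<^sub>C frame (\<lambda>i. \<alpha>\<^sub>0 + of_nat i * \<Lambda>) \<mu> j w) \<and>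
     Cowen_Douglas n (direct_sum n \<H>) T"

definition quasi_homogeneous :: "'a::complex_vector hspace \<Rightarrow> ('a \<Rightarrow> 'a) \<Rightarrow> bool" where
  "quasi_homogeneous H S \<longleftrightarrow>
     hilbert_space H \<and> bounded_op H H S \<and>
     (\<exists>n \<alpha>\<^sub>0 \<Lambda> \<mu> \<H> T.
        model_operator n \<alpha>\<^sub>0 \<Lambda> \<mu> \<H> T \<and>
        unitarily_equivalent H S (direct_sum n \<H>) T)"

end

theory Submission
  imports Defs "HOL-Real_Asymp.Real_Asymp"
begin

text \<open>
  Polynomial boundedness is used only through its consequence that the powers of \<open>T\<close> are
  uniformly bounded; this already makes a quasi-homogeneous operator similar to a contraction.
  By unitary equivalence let \<open>T\<close> be the model operator on \<open>\<H> 0 \<oplus> \<dots> \<oplus> \<H> (n - 1)\<close>, where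
  \<open>\<H> i\<close> has the weight \<open>\<alpha>\<^sub>0 + i * \<Lambda>\<close>.

  The reason is that everything is explicit on monomials.  In a weighted Bergman space the
  vectors \<open>basis_fn \<alpha> k\<close>, multiples of \<open>z ^ k\<close>, form a complete orthogonal system; they are the
  Taylor coefficients in \<open>w\<close> of the curve of atoms, and their squared norms \<open>kernel_coeff \<alpha> k\<close>
  grow like \<open>k powr (\<alpha> - 1)\<close> (lemmas \<open>basis_fn_mem_ip\<close>, \<open>expansion\<close>, \<open>kernel_coeff_growth\<close>).
  Let \<open>frame_coeff j k\<close> be the Taylor coefficients of the frame.  Since \<open>T\<close> multiplies the frame
  by \<open>w\<close>, it sends \<open>frame_coeff j (k + 1)\<close> to \<open>frame_coeff j k\<close> and \<open>frame_coeff j 0\<close> to 0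
  (lemma \<open>T_frame_coeff\<close>).

  Suppose that \<open>T\<close> is power bounded.  On \<open>\<H> 0\<close> it is the backward shift of the monomials, and
  \<open>T ^^ m\<close> maps the one of degree \<open>m\<close> to a unit vector, so the norms of the monomials do not tend
  to zero and \<open>1 \<le> \<alpha>\<^sub>0\<close> (lemma \<open>one_le_weight\<close>).  The entry of \<open>T ^^ m\<close> from \<open>\<H> 1\<close> to \<open>\<H> 0\<close> is
  \<open>- \<mu> 0 1 * m\<close> times a backward shift that reduces the degree by \<open>m - 1\<close>.  On the monomial of
  degree \<open>2 * m\<close> the quotient of the norms has order \<open>m powr (1 - \<Lambda> / 2)\<close>, and therefore
  \<open>2 \<le> \<Lambda>\<close> (lemma \<open>two_le_valency\<close>).

  Conversely, let \<open>1 \<le> \<alpha>\<^sub>0\<close> and \<open>2 \<le> \<Lambda>\<close>.  The matrix that takes the atoms to the frame is upper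
  unitriangular; its entry from \<open>\<H> j\<close> to \<open>\<H> i\<close> is a multiple of the differentiation of order
  \<open>j - i\<close>, a weighted shift that is bounded because \<open>(j - i) * \<Lambda>\<close> is at least \<open>2 * (j - i)\<close>
  (lemma \<open>derivative_shift_bound\<close>).  A unipotent bounded operator has a bounded inverse, so \<open>T\<close>
  is similar to the operator that multiplies every atom by \<open>w\<close> (lemma \<open>intertwining\<close>).  The latter
  is the direct sum of the backward shifts of the monomials, which are contractions because
  their norms increase with the degree when all weights are at least 1.
\<close>

section \<open>Inner product spaces and Hilbert spaces\<close>

lemma squeeze_to_zero:
  fixes f g :: "nat \<Rightarrow> real"
  assumes "\<And>n. 0 \<le> f n" "\<And>n. f n \<le> g n" "g \<longlonglongrightarrow> 0"
  shows "f \<longlonglongrightarrow> 0"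
  by (rule tendsto_sandwich[OF _ _ tendsto_const assms(3)]) (simp_all add: assms)

locale inner_space =
  fixes H :: "'a::complex_vector hspace"
  assumes inner_product_space: "inner_product_space H"
begin

lemmas subspace_carr = inner_product_spaceD(1)[OF inner_product_space]
lemmas ip_add_left = inner_product_spaceD(2)[OF inner_product_space]
lemmas ip_scale_left = inner_product_spaceD(3)[OF inner_product_space]
lemmas ip_sym = inner_product_spaceD(4)[OF inner_product_space]
lemmas ip_pos = inner_product_spaceD(5)[OF inner_product_space]

lemma zero_mem [simp, intro]: "0 \<in> carr H"
  using subspace_carr by (rule complex_vector.subspace_0)

lemma add_mem [simp, intro]: "x \<in> carr H \<Longrightarrow> y \<in> carr H \<Longrightarrow> x + y \<in> carr H"
  using subspace_carr by (rule complex_vector.subspace_add)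

lemma diff_mem [simp, intro]: "x \<in> carr H \<Longrightarrow> y \<in> carr H \<Longrightarrow> x - y \<in> carr H"
  using subspace_carr by (rule complex_vector.subspace_diff)

lemma scale_mem [simp, intro]: "x \<in> carr H \<Longrightarrow> c *\<^sub>C x \<in> carr H"
  using subspace_carr by (rule complex_vector.subspace_scale)

lemma sum_mem [intro]: "(\<And>i. i \<in> I \<Longrightarrow> X i \<in> carr H) \<Longrightarrow> sum X I \<in> carr H"
  using subspace_carr by (rule complex_vector.subspace_sum)

lemma ip_add_right:
  assumes "x \<in> carr H" "y \<in> carr H" "z \<in> carr H"
  shows "ip H x (y + z) = ip H x y + ip H x z"
  using assms ip_add_left[of y z x] ip_sym[of "y + z" x] ip_sym[of y x] ip_sym[of z x]
  by simp

lemma ip_scale_right: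
  assumes "x \<in> carr H" "y \<in> carr H"
  shows "ip H x (c *\<^sub>C y) = cnj c * ip H x y"
  using assms ip_scale_left[of y x c] ip_sym[of "c *\<^sub>C y" x] ip_sym[of y x] by simp

lemma ip_zero_left [simp]: "x \<in> carr H \<Longrightarrow> ip H 0 x = 0"
  using ip_scale_left[of 0 x 0] by simp

lemma ip_zero_right [simp]: "x \<in> carr H \<Longrightarrow> ip H x 0 = 0"
  using ip_scale_right[of x 0 0] by simp

lemma ip_diff_left:
  assumes "x \<in> carr H" "y \<in> carr H" "z \<in> carr H"
  shows "ip H (x - y) z = ip H x z - ip H y z"
  using assms ip_add_left[of "x - y" y z] by simp

lemma ip_diff_right:
  assumes "x \<in> carr H" "y \<in> carr H" "z \<in> carr H"
  shows "ip H x (y - z) = ip H x y - ip H x z"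
  using assms ip_add_right[of x "y - z" z] by simp

lemma ip_sum_left:
  assumes "\<And>i. i \<in> I \<Longrightarrow> X i \<in> carr H" "y \<in> carr H"
  shows "ip H (\<Sum>i\<in>I. X i) y = (\<Sum>i\<in>I. ip H (X i) y)"
  using assms(1)
proof (induction I rule: infinite_finite_induct)
  case (insert i I)
  then show ?case using assms(2) by (simp add: ip_add_left sum_mem)
qed (simp_all add: assms(2))

lemma ip_sum_right:
  assumes "\<And>i. i \<in> I \<Longrightarrow> X i \<in> carr H" "y \<in> carr H"
  shows "ip H y (\<Sum>i\<in>I. X i) = (\<Sum>i\<in>I. ip H y (X i))"
  using assms(1)
proof (induction I rule: infinite_finite_induct)
  case (insert i I)
  then show ?case using assms(2) by (simp add: ip_add_right sum_mem)
qed (simp_all add: assms(2))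

lemma ip_self_nonneg: "x \<in> carr H \<Longrightarrow> 0 \<le> Re (ip H x x)"
  using ip_pos[of x] by (cases "x = 0") auto

lemma hnorm_nonneg [simp]: "x \<in> carr H \<Longrightarrow> 0 \<le> hnorm H x"
  by (simp add: hnorm_def ip_self_nonneg)

lemma hnorm_power2: "x \<in> carr H \<Longrightarrow> (hnorm H x)\<^sup>2 = Re (ip H x x)"
  by (simp add: hnorm_def ip_self_nonneg)

lemma ip_self: "x \<in> carr H \<Longrightarrow> ip H x x = of_real ((hnorm H x)\<^sup>2)"
  using ip_sym[of x x] by (simp add: hnorm_power2 complex_eq_iff)

lemma hnorm_zero [simp]: "hnorm H 0 = 0"
  by (simp add: hnorm_def)

lemma hnorm_eq_0_iff: "x \<in> carr H \<Longrightarrow> hnorm H x = 0 \<longleftrightarrow> x = 0"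
  using ip_pos[of x] by (cases "x = 0") (auto simp: hnorm_def)

lemma hnorm_scale: "x \<in> carr H \<Longrightarrow> hnorm H (c *\<^sub>C x) = cmod c * hnorm H x"
proof -
  assume x: "x \<in> carr H"
  have "ip H (c *\<^sub>C x) (c *\<^sub>C x) = (c * cnj c) * ip H x x"
    using x by (simp add: ip_scale_left ip_scale_right)
  also have "\<dots> = of_real ((cmod c * hnorm H x)\<^sup>2)"
    using x by (simp only: complex_norm_square[symmetric] ip_self of_real_mult of_real_power
        power_mult_distrib)
  finally have "(hnorm H (c *\<^sub>C x))\<^sup>2 = (cmod c * hnorm H x)\<^sup>2"
    using x by (simp only: hnorm_power2 scale_mem Re_complex_of_real)
  then show ?thesis using x by (simp add: power2_eq_iff_nonneg)
qed

lemmas hnorm_triangle = inner_product_space_norm_triangle[OF inner_product_space]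

lemma hnorm_minus_commute:
  assumes "x \<in> carr H" "y \<in> carr H"
  shows "hnorm H (x - y) = hnorm H (y - x)"
  using hnorm_scale[of "x - y" "- 1"] assms by simp

lemma hnorm_triangle_ineq2:
  assumes "x \<in> carr H" "y \<in> carr H"
  shows "\<bar>hnorm H x - hnorm H y\<bar> \<le> hnorm H (x - y)"
  using hnorm_triangle[of "x - y" y] hnorm_triangle[of "y - x" x] hnorm_minus_commute[of x y] assms
  by simp

lemma hnorm_diff_power2:
  assumes "x \<in> carr H" "y \<in> carr H"
  shows "(hnorm H (x - y))\<^sup>2 = Re (ip H x x) - 2 * Re (ip H x y) + Re (ip H y y)"
  using assms ip_sym[of x y] by (simp add: hnorm_power2 ip_diff_left ip_diff_right)

lemma Cauchy_Schwarz:
  assumes "x \<in> carr H" "y \<in> carr H"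
  shows "cmod (ip H x y) \<le> hnorm H x * hnorm H y"
proof (cases "y = 0")
  case False
  define B where "B = (hnorm H y)\<^sup>2"
  have B: "B > 0"
    using False assms hnorm_eq_0_iff[of y] by (simp add: B_def)
  (* c *\<^sub>C y is the orthogonal projection of x to the line of y *)
  define c where "c = ip H x y / of_real B"
  have yy: "ip H y y = of_real B" using assms ip_self B_def by simp
  have cc: "c * cnj (ip H x y) = of_real ((cmod (ip H x y))\<^sup>2 / B)"
    using complex_norm_square[of "ip H x y"] by (simp add: c_def)
  have c2: "c * of_real B = ip H x y" using B by (simp add: c_def)
  have "0 \<le> Re (ip H (x - c *\<^sub>C y) (x - c *\<^sub>C y))"
    using assms by (intro ip_self_nonneg) auto
  also have "ip H (x - c *\<^sub>C y) (x - c *\<^sub>C y)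
     = ip H x x - cnj c * ip H x y - c * cnj (ip H x y) + cnj c * (c * of_real B)"
    using assms yy ip_sym[of x y]
    by (simp add: ip_diff_left ip_diff_right ip_scale_left ip_scale_right algebra_simps)
  also have "\<dots> = of_real ((hnorm H x)\<^sup>2 - (cmod (ip H x y))\<^sup>2 / B)"
    unfolding c2 cc using assms by (simp add: ip_self)
  finally have "(cmod (ip H x y))\<^sup>2 \<le> (hnorm H x)\<^sup>2 * B"
    using B by (simp add: field_simps del: of_real_diff)
  then have "(cmod (ip H x y))\<^sup>2 \<le> (hnorm H x * hnorm H y)\<^sup>2"
    by (simp add: B_def power_mult_distrib)
  then show ?thesis using assms by (simp add: power2_le_iff_abs_le)
qed (use assms in simp)

definition converges_to :: "(nat \<Rightarrow> 'a) \<Rightarrow> 'a \<Rightarrow> bool" where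
  "converges_to X x \<longleftrightarrow>
     range X \<subseteq> carr H \<and> x \<in> carr H \<and> (\<lambda>n. hnorm H (X n - x)) \<longlonglongrightarrow> 0"

lemma converges_toD:
  assumes "converges_to X x"
  shows "X n \<in> carr H" "x \<in> carr H" "(\<lambda>n. hnorm H (X n - x)) \<longlonglongrightarrow> 0"
  using assms by (auto simp: converges_to_def)

lemma converges_to_ip_left:
  assumes "converges_to X x" "y \<in> carr H"
  shows "(\<lambda>n. ip H (X n) y) \<longlonglongrightarrow> ip H x y"
proof -
  note X = converges_toD[OF assms(1)]
  have "(\<lambda>n. hnorm H (X n - x) * hnorm H y) \<longlonglongrightarrow> 0"
    using tendsto_mult_right[OF X(3)] by simp
  then have "(\<lambda>n. ip H (X n) y - ip H x y) \<longlonglongrightarrow> 0"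
    by (rule Lim_null_comparison[rotated])
      (use X assms Cauchy_Schwarz[of "X _ - x" y] in \<open>auto simp: ip_diff_left intro!: always_eventually\<close>)
  then show ?thesis by (rule LIM_zero_cancel)
qed

lemma converges_to_ip_right:
  assumes "converges_to X x" "y \<in> carr H"
  shows "(\<lambda>n. ip H y (X n)) \<longlonglongrightarrow> ip H y x"
  using tendsto_cnj[OF converges_to_ip_left[OF assms]] converges_toD[OF assms(1)]
    ip_sym[OF _ assms(2)] by simp

lemma converges_to_hnorm:
  assumes "converges_to X x"
  shows "(\<lambda>n. hnorm H (X n)) \<longlonglongrightarrow> hnorm H x"
proof -
  note X = converges_toD[OF assms(1)]
  have "(\<lambda>n. hnorm H (X n) - hnorm H x) \<longlonglongrightarrow> 0"
    by (rule Lim_null_comparison[OF _ X(3)])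
      (use X hnorm_triangle_ineq2[of "X _" x] in \<open>auto intro!: always_eventually\<close>)
  then show ?thesis by (rule LIM_zero_cancel)
qed

lemma converges_to_unique:
  assumes "converges_to X x" "converges_to X y"
  shows "x = y"
proof -
  note X = converges_toD[OF assms(1)] converges_toD[OF assms(2)]
  have "(\<lambda>n. hnorm H (X n - y) + hnorm H (X n - x)) \<longlonglongrightarrow> 0 + 0"
    by (intro tendsto_add X)
  moreover have "hnorm H (x - y) \<le> hnorm H (X n - y) + hnorm H (X n - x)" for n
    using hnorm_triangle[of "X n - y" "x - X n"] hnorm_minus_commute[of x "X n"] X by simp
  ultimately have "hnorm H (x - y) \<le> 0"
    by (intro LIMSEQ_le_const) auto
  then have "hnorm H (x - y) = 0" using X by (intro antisym) auto
  then show ?thesis using X hnorm_eq_0_iff[of "x - y"] by auto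
qed

lemma converges_to_add:
  assumes "converges_to X x" "converges_to Y y"
  shows "converges_to (\<lambda>n. X n + Y n) (x + y)"
proof -
  note X = converges_toD[OF assms(1)] converges_toD[OF assms(2)]
  have "(\<lambda>n. hnorm H (X n - x) + hnorm H (Y n - y)) \<longlonglongrightarrow> 0 + 0"
    by (intro tendsto_add X)
  then have lim: "(\<lambda>n. hnorm H (X n - x) + hnorm H (Y n - y)) \<longlonglongrightarrow> 0" by simp
  have le: "hnorm H (X n + Y n - (x + y)) \<le> hnorm H (X n - x) + hnorm H (Y n - y)" for n
    using X hnorm_triangle[of "X n - x" "Y n - y"] by (simp add: algebra_simps)
  have "(\<lambda>n. hnorm H (X n + Y n - (x + y))) \<longlonglongrightarrow> 0"
    by (rule squeeze_to_zero[OF _ le lim]) (simp add: X(1,2,4,5))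
  then show ?thesis using X by (auto simp: converges_to_def)
qed

lemma converges_to_scale:
  assumes "converges_to X x"
  shows "converges_to (\<lambda>n. c *\<^sub>C X n) (c *\<^sub>C x)"
proof -
  note X = converges_toD[OF assms(1)]
  have "hnorm H (c *\<^sub>C X n - c *\<^sub>C x) = cmod c * hnorm H (X n - x)" for n
    using X hnorm_scale[of "X n - x" c] by (simp add: complex_vector.scale_right_diff_distrib)
  then show ?thesis using X tendsto_mult_left[OF X(3), of "cmod c"] by (auto simp: converges_to_def)
qed

lemma converges_to_const: "x \<in> carr H \<Longrightarrow> converges_to (\<lambda>_. x) x"
  by (auto simp: converges_to_def)

lemma converges_to_sum:
  assumes "\<And>i. i \<in> I \<Longrightarrow> converges_to (X i) (x i)"
  shows "converges_to (\<lambda>n. \<Sum>i\<in>I. X i n) (\<Sum>i\<in>I. x i)"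
  using assms
proof (induction I rule: infinite_finite_induct)
  case (insert i I)
  then show ?case by (simp add: converges_to_add)
qed (auto intro: converges_to_const)

end

locale complete_inner_space = inner_space +
  assumes complete: "Metric_space.mcomplete (carr H) (hdist H)"
begin

lemma Cauchy_convergent:
  assumes X: "\<And>n. X n \<in> carr H"
    and Cauchy: "\<And>e. e > 0 \<Longrightarrow> \<exists>N. \<forall>m\<ge>N. \<forall>n\<ge>N. hnorm H (X m - X n) < e"
  obtains x where "converges_to X x"
proof -
  interpret M: Metric_space "carr H" "hdist H"
    by (rule inner_product_space_Metric_space[OF inner_product_space])
  have "M.MCauchy X"
    unfolding M.MCauchy_def
  proof (intro conjI allI impI)
    fix e :: real assume "e > 0"
    then obtain N where "\<forall>m\<ge>N. \<forall>n\<ge>N. hnorm H (X m - X n) < e" using Cauchy by blast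
    then show "\<exists>N. \<forall>n n'. N \<le> n \<longrightarrow> N \<le> n' \<longrightarrow> hdist H (X n) (X n') < e"
      using X by (auto simp: hdist_def)
  qed (use X in auto)
  then obtain x where x: "limitin M.mtopology X x sequentially"
    using complete by (auto simp: M.mcomplete_def)
  then have "converges_to X x"
    using X unfolding M.limit_metric_sequentially converges_to_def
    by (auto simp: hdist_def LIMSEQ_iff)
  then show ?thesis by (rule that)
qed

end

lemma complete_inner_space_iff: "complete_inner_space H \<longleftrightarrow> hilbert_space H"
  by (simp add: complete_inner_space_def complete_inner_space_axioms_def inner_space_def
      hilbert_space_def)

section \<open>Bounded operators\<close>

lemma linear_opD:
  assumes "linear_op H K A"
  shows "x \<in> carr H \<Longrightarrow> A x \<in> carr K"
    and "x \<in> carr H \<Longrightarrow> y \<in> carr H \<Longrightarrow> A (x + y) = A x + A y"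
    and "x \<in> carr H \<Longrightarrow> A (c *\<^sub>C x) = c *\<^sub>C A x"
  using assms by (auto simp: linear_op_def)

lemma bounded_op_linear: "bounded_op H K A \<Longrightarrow> linear_op H K A"
  by (simp add: bounded_op_def)

lemma linear_op_zero:
  assumes "linear_op H K A" "inner_space H"
  shows "A 0 = 0"
proof -
  interpret inner_space H by fact
  show ?thesis using linear_opD(3)[OF assms(1), of 0 0] by simp
qed

lemma linear_op_diff:
  assumes "linear_op H K A" "inner_space H" "x \<in> carr H" "y \<in> carr H"
  shows "A (x - y) = A x - A y"
proof -
  interpret inner_space H by fact
  have "A (x - y) + A y = A x"
    using linear_opD(2)[OF assms(1), of "x - y" y] assms by simp
  then show ?thesis by (metis add_diff_cancel_right')
qed

lemma linear_op_sum:
  assumes A: "linear_op H K A" "inner_space H" "\<And>i. i \<in> I \<Longrightarrow> X i \<in> carr H"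
  shows "A (\<Sum>i\<in>I. X i) = (\<Sum>i\<in>I. A (X i))"
proof -
  interpret inner_space H by fact
  show ?thesis
    using A(3)
  proof (induction I rule: infinite_finite_induct)
    case (insert i I)
    then show ?case by (simp add: linear_opD(2)[OF A(1)] sum_mem)
  qed (simp_all add: linear_op_zero[OF A(1,2)])
qed

lemma bounded_op_bound:
  assumes "bounded_op H K A" "inner_space H"
  obtains B where "B \<ge> 0" "\<And>x. x \<in> carr H \<Longrightarrow> hnorm K (A x) \<le> B * hnorm H x"
proof -
  interpret inner_space H by fact
  obtain B where B: "\<forall>x\<in>carr H. hnorm K (A x) \<le> B * hnorm H x"
    using assms by (auto simp: bounded_op_def)
  have "hnorm K (A x) \<le> \<bar>B\<bar> * hnorm H x" if "x \<in> carr H" for x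
  proof -
    have "B * hnorm H x \<le> \<bar>B\<bar> * hnorm H x" using that by (intro mult_right_mono) auto
    then show ?thesis using B that by force
  qed
  then show ?thesis by (intro that[of "\<bar>B\<bar>"]) auto
qed

lemma bounded_op_compose:
  assumes A: "bounded_op G H A" and B: "bounded_op H K B" and "inner_space G" "inner_space H"
  shows "bounded_op G K (\<lambda>x. B (A x))"
proof -
  obtain a where a: "a \<ge> 0" "\<And>x. x \<in> carr G \<Longrightarrow> hnorm H (A x) \<le> a * hnorm G x"
    using bounded_op_bound[OF A assms(3)] by blast
  obtain b where b: "b \<ge> 0" "\<And>x. x \<in> carr H \<Longrightarrow> hnorm K (B x) \<le> b * hnorm H x"
    using bounded_op_bound[OF B assms(4)] by blast
  note lA = linear_opD[OF bounded_op_linear[OF A]] and lB = linear_opD[OF bounded_op_linear[OF B]]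
  have "hnorm K (B (A x)) \<le> (b * a) * hnorm G x" if "x \<in> carr G" for x
    using order.trans[OF b(2)[OF lA(1)[OF that]] mult_left_mono[OF a(2)[OF that] b(1)]] by simp
  then show ?thesis
    unfolding bounded_op_def linear_op_def using lA lB by auto
qed

lemma bounded_op_ident: "bounded_op H H (\<lambda>x. x)"
  unfolding bounded_op_def linear_op_def by (auto intro!: exI[of _ 1])

lemma bounded_op_power:
  assumes "bounded_op H H A" "inner_space H"
  shows "bounded_op H H (A ^^ m)"
proof (induction m)
  case 0
  then show ?case using bounded_op_ident by (simp add: id_def)
next
  case (Suc m)
  then show ?case using bounded_op_compose[OF Suc assms(1)] assms(2) by (simp add: o_def)
qed

lemma bounded_op_zero: "inner_space K \<Longrightarrow> bounded_op H K (\<lambda>x. 0)"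
proof -
  assume "inner_space K"
  then interpret K: inner_space K .
  show ?thesis unfolding bounded_op_def linear_op_def by (auto intro!: exI[of _ 0])
qed

lemma bounded_op_scale:
  assumes A: "bounded_op H K A" and "inner_space H" "inner_space K"
  shows "bounded_op H K (\<lambda>x. c *\<^sub>C A x)"
proof -
  interpret H: inner_space H by fact
  interpret K: inner_space K by fact
  obtain a where a: "a \<ge> 0" "\<And>x. x \<in> carr H \<Longrightarrow> hnorm K (A x) \<le> a * hnorm H x"
    using bounded_op_bound[OF A assms(2)] by blast
  note lA = linear_opD[OF bounded_op_linear[OF A]]
  have "hnorm K (c *\<^sub>C A x) \<le> (cmod c * a) * hnorm H x" if "x \<in> carr H" for x
    using that lA mult_left_mono[OF a(2)[OF that], of "cmod c"] by (simp add: K.hnorm_scale mult.assoc)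
  then show ?thesis
    unfolding bounded_op_def linear_op_def using lA
    by (auto simp: scaleC_add_right scaleC_scaleC mult.commute[of c] intro!: exI[of _ "cmod c * a"])
qed

lemma bounded_op_add:
  assumes A: "bounded_op H K A" and B: "bounded_op H K B" and "inner_space H" "inner_space K"
  shows "bounded_op H K (\<lambda>x. A x + B x)"
proof -
  interpret H: inner_space H by fact
  interpret K: inner_space K by fact
  obtain a where a: "a \<ge> 0" "\<And>x. x \<in> carr H \<Longrightarrow> hnorm K (A x) \<le> a * hnorm H x"
    using bounded_op_bound[OF A assms(3)] by blast
  obtain b where b: "b \<ge> 0" "\<And>x. x \<in> carr H \<Longrightarrow> hnorm K (B x) \<le> b * hnorm H x"
    using bounded_op_bound[OF B assms(3)] by blast
  note lA = linear_opD[OF bounded_op_linear[OF A]] and lB = linear_opD[OF bounded_op_linear[OF B]]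
  have "hnorm K (A x + B x) \<le> (a + b) * hnorm H x" if "x \<in> carr H" for x
    using that lA lB K.hnorm_triangle[of "A x" "B x"] a(2)[OF that] b(2)[OF that]
    by (simp add: distrib_right)
  then show ?thesis
    unfolding bounded_op_def linear_op_def using lA lB
    by (auto simp: scaleC_add_right add_ac intro!: exI[of _ "a + b"])
qed

lemma bounded_op_sum:
  assumes "\<And>i. i \<in> I \<Longrightarrow> bounded_op H K (A i)" and "inner_space H" "inner_space K"
  shows "bounded_op H K (\<lambda>x. \<Sum>i\<in>I. A i x)"
  using assms(1)
proof (induction I rule: infinite_finite_induct)
  case (insert i I)
  then show ?case using bounded_op_add[of H K "A i"] assms by simp
qed (use bounded_op_zero assms in \<open>simp_all\<close>)

lemma bounded_op_converges_to:
  assumes A: "bounded_op H K A" and "inner_space H" "inner_space K"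
    and X: "inner_space.converges_to H X x"
  shows "inner_space.converges_to K (\<lambda>n. A (X n)) (A x)"
proof -
  interpret H: inner_space H by fact
  interpret K: inner_space K by fact
  obtain a where a: "a \<ge> 0" "\<And>x. x \<in> carr H \<Longrightarrow> hnorm K (A x) \<le> a * hnorm H x"
    using bounded_op_bound[OF A assms(2)] by blast
  note lin = bounded_op_linear[OF A]
  note lA = linear_opD[OF lin] and X' = H.converges_toD[OF X]
  have lim: "(\<lambda>n. a * hnorm H (X n - x)) \<longlonglongrightarrow> 0"
    using tendsto_mult_left[OF X'(3), of a] by simp
  have le: "hnorm K (A (X n) - A x) \<le> a * hnorm H (X n - x)" for n
    using a(2)[of "X n - x"] X'(1,2) linear_op_diff[OF lin assms(2)] by simp
  have "(\<lambda>n. hnorm K (A (X n) - A x)) \<longlonglongrightarrow> 0"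
    by (rule squeeze_to_zero[OF _ le lim]) (simp add: X'(1,2) lA(1))
  then show ?thesis using X' lA by (auto simp: K.converges_to_def)
qed

text \<open>
  The inverse is the finite geometric series \<open>\<Sum>k<n. (- N) ^^ k\<close>, which is bounded because \<open>N\<close> is.
\<close>

lemma nilpotent_perturbation_invertible:
  assumes N: "bounded_op H H N" and H: "inner_space H"
    and nil: "\<And>x. x \<in> carr H \<Longrightarrow> (N ^^ n) x = 0"
  obtains L' where "bounded_op H H L'"
    and "\<And>x. x \<in> carr H \<Longrightarrow> L' (x + N x) = x \<and> L' x + N (L' x) = x"
proof -
  interpret inner_space H by fact
  define M where "M = (\<lambda>x. (- 1) *\<^sub>C N x)"
  have M: "bounded_op H H M"
    unfolding M_def by (rule bounded_op_scale[OF N H H])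
  note lM = bounded_op_linear[OF bounded_op_power[OF M H]] and lN = bounded_op_linear[OF N]
  have Mpow: "(M ^^ k) x = (- 1) ^ k *\<^sub>C (N ^^ k) x" if "x \<in> carr H" for k x
  proof (induction k)
    case (Suc k)
    have "(N ^^ k) x \<in> carr H"
      using linear_opD(1)[OF bounded_op_linear[OF bounded_op_power[OF N H]] that] .
    then show ?case
      using Suc by (simp add: M_def linear_opD(3)[OF lN] scaleC_scaleC del: complex_vector.scale_minus_left)
  qed (simp add: scaleC_one)
  have Mn: "(M ^^ n) x = 0" if "x \<in> carr H" for x
    using Mpow[OF that] nil[OF that] by simp
  define L' where "L' = (\<lambda>x. \<Sum>k<n. (M ^^ k) x)"
  have L': "bounded_op H H L'"
    unfolding L'_def using bounded_op_power[OF M H] H by (intro bounded_op_sum) auto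
  have Mmem: "(M ^^ k) x \<in> carr H" if "x \<in> carr H" for k x
    using linear_opD(1)[OF lM that] .
  have Nx: "N x = - M x" for x by (simp add: M_def)
  have Mx: "M x \<in> carr H" if "x \<in> carr H" for x using Mmem[OF that, of 1] by simp
  have tel: "(\<Sum>k<n. (M ^^ k) x) - (\<Sum>k<n. (M ^^ Suc k) x) = x" if "x \<in> carr H" for x
    using Mn[OF that] sum_lessThan_telescope'[of "\<lambda>k. (M ^^ k) x" n] by (simp add: sum_subtractf)
  have "L' (x + N x) = x" if x: "x \<in> carr H" for x
  proof -
    have "L' (x + N x) = (\<Sum>k<n. (M ^^ k) x - (M ^^ k) (M x))"
      unfolding L'_def using x Mx[OF x] linear_op_diff[OF lM H]
      by (intro sum.cong) (simp_all add: Nx)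
    then show ?thesis using tel[OF x] by (simp add: sum_subtractf funpow_swap1)
  qed
  moreover have "L' x + N (L' x) = x" if x: "x \<in> carr H" for x
  proof -
    have "M (L' x) = (\<Sum>k<n. (M ^^ Suc k) x)"
      unfolding L'_def
      using linear_op_sum[OF bounded_op_linear[OF M] H, of "{..<n}" "\<lambda>k. (M ^^ k) x"] x Mmem by simp
    then show ?thesis using tel[OF x] by (simp add: Nx L'_def)
  qed
  ultimately show ?thesis using L' that by blast
qed

section \<open>The Taylor coefficients of the kernel\<close>

text \<open>
  The kernel \<open>(1 - u) powr (- \<alpha>)\<close> is \<open>\<Sum>k. kernel_coeff \<alpha> k * u ^ k\<close>. These numbers determine
  the space: they are the squared norms of the monomials in the normalization used below.
\<close>

definition kernel_coeff :: "real \<Rightarrow> nat \<Rightarrow> real" where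
  "kernel_coeff \<alpha> k = pochhammer \<alpha> k / fact k"

lemma kernel_coeff_0 [simp]: "kernel_coeff \<alpha> 0 = 1"
  by (simp add: kernel_coeff_def)

lemma kernel_coeff_pos [simp]: "0 < \<alpha> \<Longrightarrow> 0 < kernel_coeff \<alpha> k"
  by (simp add: kernel_coeff_def pochhammer_pos)

lemma kernel_coeff_nonneg [simp]: "0 < \<alpha> \<Longrightarrow> 0 \<le> kernel_coeff \<alpha> k"
  using kernel_coeff_pos[of \<alpha> k] by linarith

lemma kernel_coeff_Suc: "kernel_coeff \<alpha> (Suc k) = kernel_coeff \<alpha> k * ((\<alpha> + real k) / (real k + 1))"
  by (simp add: kernel_coeff_def pochhammer_Suc field_simps)

lemma kernel_coeff_mono:
  assumes "1 \<le> \<alpha>"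
  shows "kernel_coeff \<alpha> k \<le> kernel_coeff \<alpha> (Suc k)"
proof -
  have "kernel_coeff \<alpha> k * 1 \<le> kernel_coeff \<alpha> k * ((\<alpha> + real k) / (real k + 1))"
    using assms by (intro mult_left_mono) auto
  then show ?thesis by (simp add: kernel_coeff_Suc)
qed

lemma kernel_coeff_sums:
  assumes "cmod u < 1"
  shows "(\<lambda>k. of_real (kernel_coeff \<alpha> k) * u ^ k) sums (1 - u) powr (- of_real \<alpha>)"
proof -
  have "((- of_real \<alpha> :: complex) gchoose k) * (- u) ^ k = of_real (kernel_coeff \<alpha> k) * u ^ k" for k
  proof -
    have "(- 1 :: complex) ^ k * (- u) ^ k = u ^ k"
      unfolding power_mult_distrib[symmetric] by simp
    then show ?thesis
      by (simp add: gbinomial_pochhammer kernel_coeff_def pochhammer_of_real[symmetric] mult_ac)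
  qed
  then show ?thesis
    using gen_binomial_complex[of "- u" "- of_real \<alpha>"] assms by simp
qed

text \<open>
  Gauss's product formula for the Gamma function says that
  \<open>kernel_coeff \<alpha> k / k powr (\<alpha> - 1)\<close> tends to \<open>1 / Gamma \<alpha>\<close>, a positive number; a positive
  sequence with a positive limit is bounded away from zero and from infinity.
\<close>

lemma kernel_coeff_growth:
  assumes "0 < \<alpha>"
  obtains c C where "0 < c" "0 < C"
    and "\<And>k. c * (real k + 1) powr (\<alpha> - 1) \<le> kernel_coeff \<alpha> k"
    and "\<And>k. kernel_coeff \<alpha> k \<le> C * (real k + 1) powr (\<alpha> - 1)"
proof -
  define q where "q = (\<lambda>k. kernel_coeff \<alpha> k / (real k + 1) powr (\<alpha> - 1))"
  have q_pos: "q k > 0" for k using assms by (simp add: q_def)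
  have G: "Gamma \<alpha> > 0" using assms by (rule Gamma_real_pos)
  have "(\<lambda>k. Gamma_series' \<alpha> k * ((real k + 1) / real k) powr (\<alpha> - 1)) \<longlonglongrightarrow> Gamma \<alpha> * 1"
    by (intro tendsto_mult Gamma_series'_LIMSEQ) real_asymp
  moreover have "\<forall>\<^sub>F k in sequentially.
      Gamma_series' \<alpha> k * ((real k + 1) / real k) powr (\<alpha> - 1) = inverse (q k)"
    using eventually_gt_at_top[of 0]
  proof eventually_elim
    case (elim k)
    have "(fact k :: real) = real k * fact (k - 1)" using elim by (simp add: fact_reduce)
    moreover have "exp (\<alpha> * ln (real k)) = real k powr (\<alpha> - 1) * real k"
      using elim by (simp add: powr_def algebra_simps exp_diff)
    ultimately show ?case
      using elim assms pochhammer_pos[OF assms, of k]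
      by (simp add: Gamma_series'_def q_def kernel_coeff_def powr_divide divide_simps)
  qed
  ultimately have lim: "(\<lambda>k. inverse (q k)) \<longlonglongrightarrow> Gamma \<alpha>"
    by (simp add: tendsto_cong)
  then have "q \<longlonglongrightarrow> inverse (Gamma \<alpha>)"
    using tendsto_inverse[OF lim] G by simp
  then obtain C where C: "C > 0" "\<And>k. norm (q k) \<le> C"
    using convergent_imp_Bseq[unfolded convergent_def] by (metis BseqE)
  obtain D where D: "D > 0" "\<And>k. norm (inverse (q k)) \<le> D"
    using lim convergent_imp_Bseq[unfolded convergent_def] by (metis BseqE)
  show ?thesis
  proof (rule that[of "inverse D" C])
    fix k
    have "inverse D \<le> q k"
      using D(2)[of k] q_pos[of k] D(1) by (simp add: field_simps)
    then show "inverse D * (real k + 1) powr (\<alpha> - 1) \<le> kernel_coeff \<alpha> k"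
      by (simp add: q_def field_simps)
    show "kernel_coeff \<alpha> k \<le> C * (real k + 1) powr (\<alpha> - 1)"
      using C(2)[of k] q_pos[of k] by (simp add: q_def field_simps)
  qed (use C D in auto)
qed

text \<open>
  Both sides are the coefficient of \<open>u ^ k\<close> in the \<open>m\<close>-th derivative of the kernel: the left one
  in its closed form, the right one after differentiating term by term.
\<close>

lemma pochhammer_times_kernel_coeff:
  "pochhammer \<alpha> m * kernel_coeff (\<alpha> + real m) k = pochhammer (real k + 1) m * kernel_coeff \<alpha> (k + m)"
proof -
  have "(fact (k + m) :: real) = fact k * pochhammer (real k + 1) m"
    unfolding pochhammer_fact using pochhammer_product'[of "1::real" k m] by (simp add: add.commute)
  moreover have "pochhammer (real k + 1) m > 0" by (intro pochhammer_pos) simp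
  ultimately show ?thesis
    unfolding kernel_coeff_def add.commute[of k m] pochhammer_product'[of \<alpha> m k]
    by (simp add: divide_simps)
qed

lemma higher_deriv_kernel:
  fixes z w :: complex
  assumes "z \<in> ball 0 1" "w \<in> ball 0 1"
  shows "(deriv ^^ m) (\<lambda>v. (1 - z * v) powr (- of_real \<alpha>)) w =
    z ^ m * of_real (pochhammer \<alpha> m) * (1 - z * w) powr (- of_real (\<alpha> + real m))"
  using assms(2)
proof (induction m arbitrary: w)
  case (Suc m)
  define F where "F = (\<lambda>v. z ^ m * of_real (pochhammer \<alpha> m) * (1 - z * v) powr (- of_real (\<alpha> + real m)))"
  have "\<forall>\<^sub>F v in nhds w. v \<in> ball 0 1"
    using Suc.prems by (intro eventually_nhds_in_open) auto
  then have "\<forall>\<^sub>F v in nhds w. (deriv ^^ m) (\<lambda>v. (1 - z * v) powr (- of_real \<alpha>)) v = F v"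
    by (rule eventually_mono) (simp only: F_def Suc.IH)
  then have "(deriv ^^ Suc m) (\<lambda>v. (1 - z * v) powr (- of_real \<alpha>)) w = deriv F w"
    by (simp add: deriv_cong_ev)
  also have "deriv F w =
      z ^ Suc m * of_real (pochhammer \<alpha> (Suc m)) * (1 - z * w) powr (- of_real (\<alpha> + real (Suc m)))"
  proof (rule DERIV_imp_deriv)
    have "cmod (z * w) < 1"
      using assms(1) Suc.prems mult_strict_mono'[of "cmod z" 1 "cmod w" 1] by (simp add: norm_mult)
    then have "Re (z * w) < 1" using abs_Re_le_cmod[of "z * w"] by linarith
    then have nonneg: "1 - z * w \<notin> \<real>\<^sub>\<le>\<^sub>0"
      by (auto simp: complex_nonpos_Reals_iff)
    have ex: "- complex_of_real \<alpha> - (1 + of_nat m) = - 1 - (of_nat m + of_real \<alpha>)" by simp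
    show "(F has_field_derivative
        z ^ Suc m * of_real (pochhammer \<alpha> (Suc m)) * (1 - z * w) powr (- of_real (\<alpha> + real (Suc m)))) (at w)"
      unfolding F_def
      by (rule derivative_eq_intros has_field_derivative_powr refl nonneg | simp add: nonneg)+
        (simp add: pochhammer_Suc ex algebra_simps)
  qed
  finally show ?case .
qed (simp)

text \<open>
  The ratios of consecutive coefficients tend to 1, so the power series in \<open>r\<close> has radius of
  convergence 1.
\<close>

lemma summable_derivative_weights:
  assumes "0 < \<alpha>" "0 \<le> r" "r < 1"
  shows "summable (\<lambda>k. (pochhammer (real k + 1) m)\<^sup>2 * kernel_coeff \<alpha> (k + m) * r ^ k)"
proof -
  define b where "b = (\<lambda>k. (pochhammer (real k + 1) m)\<^sup>2 * kernel_coeff \<alpha> (k + m))"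
  have P: "pochhammer (real k + 1) m > 0" for k by (intro pochhammer_pos) simp
  have b_pos: "b k > 0" for k using P[of k] assms by (simp add: b_def)
  have ratio: "b k / b (Suc k) =
      ((real k + 1) / (real k + 1 + real m))\<^sup>2 * ((real k + real m + 1) / (\<alpha> + real k + real m))" for k
  proof -
    have "(real k + 1) * pochhammer (real (Suc k) + 1) m = pochhammer (real k + 1) m * (real k + 1 + real m)"
      using pochhammer_rec[of "real k + 1" m] pochhammer_Suc[of "real k + 1" m] by (simp add: algebra_simps)
    then have p': "pochhammer (real (Suc k) + 1) m = pochhammer (real k + 1) m * (real k + 1 + real m) / (real k + 1)"
      by (simp add: field_simps)
    have A': "kernel_coeff \<alpha> (Suc k + m) =
        kernel_coeff \<alpha> (k + m) * ((\<alpha> + real k + real m) / (real k + real m + 1))"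
      using kernel_coeff_Suc[of \<alpha> "k + m"] by (simp add: add.assoc)
    have cancel: "p\<^sup>2 * A / ((p * s / t)\<^sup>2 * (A * (x / y))) = (t / s)\<^sup>2 * (y / x)"
      if "p > 0" "A > 0" for p A s t x y :: real
      using that by (simp add: power_divide power_mult_distrib)
    show ?thesis
      unfolding b_def p' A' using P[of k] kernel_coeff_pos[OF assms(1)] by (intro cancel)
  qed
  have "(\<lambda>k. (real k + 1) / (real k + 1 + real m)) \<longlonglongrightarrow> 1" by real_asymp
  moreover have "(\<lambda>k. (real k + real m + 1) / (\<alpha> + real k + real m)) \<longlonglongrightarrow> 1" by real_asymp
  ultimately have "(\<lambda>k. b k / b (Suc k)) \<longlonglongrightarrow> 1\<^sup>2 * 1"
    unfolding ratio by (intro tendsto_mult tendsto_power)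
  then have "(\<lambda>k. norm (b k) / norm (b (Suc k))) \<longlonglongrightarrow> 1"
    using b_pos by (simp add: less_imp_le)
  then have "conv_radius b = 1"
    by (intro conv_radius_ratio_limit_nonzero[of _ 1]) (auto simp: one_ereal_def)
  then have "summable (\<lambda>k. b k * r ^ k)"
    using assms by (intro summable_in_conv_radius) (simp add: one_ereal_def)
  then show ?thesis by (simp add: b_def)
qed

section \<open>Weighted Bergman spaces\<close>

definition atom :: "real \<Rightarrow> complex \<Rightarrow> complex \<Rightarrow> complex" where
  "atom \<alpha> w = on_disc (\<lambda>z. (1 - z * w) powr (- of_real \<alpha>))"

text \<open>
  The scaling is chosen such that \<open>atom \<alpha> w\<close> is \<open>\<Sum>k. w ^ k *\<^sub>C basis_fn \<alpha> k\<close>.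
\<close>

definition basis_fn :: "real \<Rightarrow> nat \<Rightarrow> complex \<Rightarrow> complex" where
  "basis_fn \<alpha> k = on_disc (\<lambda>z. of_real (kernel_coeff \<alpha> k) * z ^ k)"

lemma atom_deriv_0: "atom_deriv \<alpha> 0 w = atom \<alpha> w"
  by (simp add: atom_deriv_def atom_def)

lemma sum_fun_apply: "(\<Sum>i\<in>I. f i) x = (\<Sum>i\<in>I. f i x)"
  by (induction I rule: infinite_finite_induct) (auto simp: plus_fun_def zero_fun_def)

lemma scaleC_fun_apply: "(c *\<^sub>C f) x = c *\<^sub>C f x"
  by (simp add: scaleC_fun_def)

lemma kernel_coeff_sums_mult:
  fixes z w :: complex
  assumes "z \<in> ball 0 1" "w \<in> ball 0 1"
  shows "(\<lambda>k. of_real (kernel_coeff \<alpha> k) * (z * w) ^ k) sums (1 - z * w) powr (- of_real \<alpha>)"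
proof (rule kernel_coeff_sums)
  show "cmod (z * w) < 1"
    using assms mult_strict_mono'[of "cmod z" 1 "cmod w" 1] by (simp add: norm_mult)
qed

locale weighted_bergman =
  fixes \<alpha> :: real and H :: "(complex \<Rightarrow> complex) hspace"
  assumes weight_pos: "0 < \<alpha>" and weighted_bergman: "is_weighted_bergman \<alpha> H"

sublocale weighted_bergman \<subseteq> complete_inner_space H
  using weighted_bergman by (simp add: is_weighted_bergman_def complete_inner_space_iff)

context weighted_bergman
begin

lemma on_disc_eq: "f \<in> carr H \<Longrightarrow> on_disc f = f"
  using weighted_bergman by (simp add: is_weighted_bergman_def)

lemma atom_mem [simp, intro]: "w \<in> ball 0 1 \<Longrightarrow> atom \<alpha> w \<in> carr H"
  using weighted_bergman[unfolded is_weighted_bergman_def, THEN conjunct2, THEN conjunct2,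
      rule_format, of "cnj w"]
  by (simp add: atom_def)

lemma reproducing: "f \<in> carr H \<Longrightarrow> w \<in> ball 0 1 \<Longrightarrow> ip H f (atom \<alpha> w) = f (cnj w)"
  using weighted_bergman[unfolded is_weighted_bergman_def, THEN conjunct2, THEN conjunct2,
      rule_format, of "cnj w"]
  by (simp add: atom_def)

lemma eq_if_eq_on_disc:
  assumes "f \<in> carr H" "\<And>z. z \<in> ball 0 1 \<Longrightarrow> f z = g z" "on_disc g = g"
  shows "f = g"
proof
  fix z
  show "f z = g z"
    using fun_cong[OF on_disc_eq[OF assms(1)], of z] fun_cong[OF assms(3), of z] assms(2)[of z]
    by (cases "z \<in> ball 0 1") (simp_all only: on_disc_def if_True if_False)
qed

lemma converges_to_eval:
  assumes "converges_to X f"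
  shows "(\<lambda>n. X n z) \<longlonglongrightarrow> f z"
proof (cases "z \<in> ball 0 1")
  case True
  then have "(\<lambda>n. ip H (X n) (atom \<alpha> (cnj z))) \<longlonglongrightarrow> ip H f (atom \<alpha> (cnj z))"
    using assms by (intro converges_to_ip_left) auto
  then show ?thesis using True converges_toD[OF assms] by (simp add: reproducing)
next
  case False
  have zero: "g z = 0" if "g \<in> carr H" for g
    using on_disc_eq[OF that] False by (metis on_disc_def)
  show ?thesis using zero[OF converges_toD(1)[OF assms]] zero[OF converges_toD(2)[OF assms]] by simp
qed

lemma on_disc_basis_fn: "on_disc (basis_fn \<alpha> k) = basis_fn \<alpha> k"
  by (auto simp: basis_fn_def on_disc_def)

text \<open>
  The monomials are recovered from the kernel functions by induction: the remainder
  \<open>h w\<close> of \<open>atom \<alpha> w\<close> after \<open>k\<close> Taylor terms, divided by \<open>w ^ k\<close>, is orthogonal to the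
  earlier monomials, and the reproducing property turns its Gram matrix into
  \<open>ip H (h v) (h w) = \<phi> (v * w)\<close> (for real \<open>v\<close>, \<open>w\<close>) with a function \<open>\<phi>\<close> that is continuous
  at 0.  Hence \<open>h w\<close> is Cauchy as \<open>w\<close> tends to 0, and its limit is the next monomial.
\<close>

lemma basis_fn_mem_ip:
  "basis_fn \<alpha> k \<in> carr H \<and>
   (\<forall>l\<le>k. ip H (basis_fn \<alpha> k) (basis_fn \<alpha> l) = (if l = k then of_real (kernel_coeff \<alpha> k) else 0))"
proof (induction k rule: less_induct)
  case (less k)
  let ?b = "basis_fn \<alpha>" and ?a = "\<lambda>k. complex_of_real (kernel_coeff \<alpha> k)"
  have mem: "?b j \<in> carr H" if "j < k" for j using less that by blast
  have orth: "ip H (?b i) (?b j) = (if i = j then ?a j else 0)" if "i < k" "j < k" for i j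
  proof (cases "j \<le> i")
    case True
    then show ?thesis using less that by auto
  next
    case False
    then have "ip H (?b j) (?b i) = 0" using less that by auto
    then show ?thesis using ip_sym[OF mem mem, of j i] that False by simp
  qed
  have ball: "z * w \<in> ball 0 1" if "z \<in> ball 0 1" "w \<in> ball 0 1" for z w :: complex
    using that mult_strict_mono'[of "cmod z" 1 "cmod w" 1] by (simp add: norm_mult)
  define \<phi> where "\<phi> = (\<lambda>u::complex. \<Sum>i. ?a (i + k) * u ^ i)"
  have \<phi>_sums: "(\<lambda>i. ?a (i + k) * u ^ i) sums \<phi> u" if "u \<in> ball 0 1" for u
  proof (cases "u = 0")
    case True
    then show ?thesis unfolding \<phi>_def by (simp only: True summable_0_powser summable_sums)
  next
    case False
    have "summable (\<lambda>i. ?a (i + k) * u ^ (i + k))"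
      using kernel_coeff_sums[of u \<alpha>] that
      by (intro summable_ignore_initial_segment[where f = "\<lambda>i. ?a i * u ^ i"]) (auto simp: sums_iff)
    then have "summable (\<lambda>i. ?a (i + k) * u ^ (i + k) * inverse (u ^ k))" by (rule summable_mult2)
    moreover have "?a (i + k) * u ^ (i + k) * inverse (u ^ k) = ?a (i + k) * u ^ i" for i
      using False by (simp add: power_add)
    ultimately show ?thesis unfolding \<phi>_def by (intro summable_sums) simp
  qed
  have \<phi>_tail: "u ^ k * \<phi> u = (1 - u) powr (- of_real \<alpha>) - (\<Sum>j<k. ?a j * u ^ j)"
    if "u \<in> ball 0 1" for u
  proof -
    have "(\<lambda>i. ?a (i + k) * u ^ (i + k)) sums ((1 - u) powr (- of_real \<alpha>) - (\<Sum>j<k. ?a j * u ^ j))"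
      using kernel_coeff_sums[of u \<alpha>] that by (intro sums_split_initial_segment) auto
    moreover have "(\<lambda>i. u ^ k * (?a (i + k) * u ^ i)) sums (u ^ k * \<phi> u)"
      using \<phi>_sums[OF that] by (rule sums_mult)
    ultimately show ?thesis by (simp add: power_add mult_ac sums_iff)
  qed
  have "(\<phi> \<longlongrightarrow> ?a (0 + k)) (at 0)"
    by (rule powser_limit_0[of 1]) (use \<phi>_sums in auto)
  moreover have "\<phi> 0 = ?a k"
    using \<phi>_sums[of 0] powser_sums_zero[of "\<lambda>i. ?a (i + k)"] by (simp add: sums_iff)
  ultimately have "isCont \<phi> 0" by (simp add: isCont_def)
  then have \<phi>_lim: "(\<lambda>n. \<phi> (u n)) \<longlonglongrightarrow> ?a k" if "u \<longlonglongrightarrow> 0" for u :: "nat \<Rightarrow> complex"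
    using isCont_tendsto_compose[of 0 \<phi> u] that \<open>\<phi> 0 = ?a k\<close> by simp

  define s where "s = (\<lambda>n::nat. 1 / complex_of_nat (n + 2))"
  have s: "s n \<in> ball 0 1" "s n \<noteq> 0" "cnj (s n) = s n" for n
  proof -
    have nz: "complex_of_nat (n + 2) \<noteq> 0" by (simp only: of_nat_eq_0_iff)
    then show "s n \<noteq> 0" by (simp only: s_def) simp
    show "cnj (s n) = s n" by (simp only: s_def complex_cnj_divide complex_cnj_of_nat complex_cnj_one)
    have "cmod (s n) = 1 / real (n + 2)" by (simp only: s_def norm_divide norm_of_nat norm_one)
    then show "s n \<in> ball 0 1" by simp
  qed
  have s_lim: "s \<longlonglongrightarrow> 0"
    unfolding s_def using LIMSEQ_ignore_initial_segment[OF lim_1_over_n, of 2] by simp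
  define h where "h = (\<lambda>n. inverse (s n ^ k) *\<^sub>C (atom \<alpha> (s n) - (\<Sum>j<k. s n ^ j *\<^sub>C ?b j)))"
  have h_mem: "h n \<in> carr H" for n
    unfolding h_def using s(1) mem by (intro scale_mem diff_mem sum_mem atom_mem) auto
  have h_eval: "h n z = z ^ k * \<phi> (z * s n)" if z: "z \<in> ball 0 1" for n z
  proof -
    have "(\<Sum>j<k. s n ^ j *\<^sub>C ?b j) z = (\<Sum>j<k. ?a j * (z * s n) ^ j)"
      using z by (simp add: sum_fun_apply scaleC_fun_apply scaleC_complex_def basis_fn_def
          on_disc_def power_mult_distrib mult_ac)
    then have "h n z = inverse (s n ^ k) * ((z * s n) ^ k * \<phi> (z * s n))"
      using z \<phi>_tail[OF ball[OF z s(1)]]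
      by (simp add: h_def scaleC_fun_apply scaleC_complex_def fun_diff_def atom_def on_disc_def)
    then show ?thesis using s(2) by (simp add: power_mult_distrib)
  qed
  have h_orth: "ip H (h n) (?b l) = 0" if l: "l < k" for n l
  proof -
    have "ip H (atom \<alpha> (s n)) (?b l) = cnj (?b l (cnj (s n)))"
      using ip_sym[OF mem[OF l] atom_mem[OF s(1)]] reproducing[OF mem[OF l] s(1)] by simp
    also have "\<dots> = ?a l * s n ^ l" using s by (simp add: basis_fn_def on_disc_def)
    finally have A: "ip H (atom \<alpha> (s n)) (?b l) = ?a l * s n ^ l" .
    have "ip H (\<Sum>j<k. s n ^ j *\<^sub>C ?b j) (?b l) = (\<Sum>j<k. s n ^ j * ip H (?b j) (?b l))"
      using mem l by (subst ip_sum_left) (auto simp: ip_scale_left)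
    also have "\<dots> = (\<Sum>j<k. if j = l then s n ^ l * ?a l else 0)"
      using orth l by (intro sum.cong) auto
    also have "\<dots> = ?a l * s n ^ l" using l by simp
    finally have B: "ip H (\<Sum>j<k. s n ^ j *\<^sub>C ?b j) (?b l) = ?a l * s n ^ l" .
    have m: "(\<Sum>j<k. s n ^ j *\<^sub>C ?b j) \<in> carr H" using mem by (intro sum_mem scale_mem) auto
    show ?thesis
      unfolding h_def using A B m s(1) mem[OF l]
      by (simp add: ip_scale_left ip_diff_left)
  qed
  have ip_h: "ip H f (h n) = f (s n) / s n ^ k"
    if f: "f \<in> carr H" and orth_f: "\<And>j. j < k \<Longrightarrow> ip H f (?b j) = 0" for f n
  proof -
    have "ip H f (\<Sum>j<k. s n ^ j *\<^sub>C ?b j) = 0"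
      using mem f orth_f by (subst ip_sum_right) (auto simp: ip_scale_right)
    moreover have m: "(\<Sum>j<k. s n ^ j *\<^sub>C ?b j) \<in> carr H" using mem by (intro sum_mem scale_mem) auto
    ultimately show ?thesis
      unfolding h_def using f s(1,3)[of n] reproducing[OF f s(1)[of n]]
      by (simp add: ip_scale_right ip_diff_right field_simps)
  qed
  have gram: "ip H (h m) (h n) = \<phi> (s n * s m)" for m n
    using ip_h[OF h_mem h_orth, of m n] h_eval[OF s(1), of m n] s(2)[of n] by simp
  obtain e where e: "converges_to h e"
  proof (rule Cauchy_convergent[of h, OF h_mem])
    fix d :: real assume d: "d > 0"
    then obtain \<delta> where \<delta>: "\<delta> > 0" "\<And>u. cmod u < \<delta> \<Longrightarrow> cmod (\<phi> u - ?a k) < d\<^sup>2 / 4"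
      using \<open>isCont \<phi> 0\<close> \<open>\<phi> 0 = ?a k\<close> unfolding continuous_at_eps_delta
      by (metis dist_norm diff_zero zero_less_divide_iff zero_less_numeral zero_less_power)
    from s_lim \<delta>(1) obtain N where N: "\<And>n. n \<ge> N \<Longrightarrow> cmod (s n) < \<delta>"
      unfolding LIMSEQ_iff by auto
    have small: "\<bar>Re (\<phi> (s n * s m)) - kernel_coeff \<alpha> k\<bar> < d\<^sup>2 / 4" if "n \<ge> N" for m n
    proof -
      have "cmod (s n) * cmod (s m) \<le> cmod (s n) * 1"
        using s(1)[of m] by (intro mult_left_mono) auto
      then have "cmod (\<phi> (s n * s m) - ?a k) < d\<^sup>2 / 4"
        using N[OF that] by (intro \<delta>(2)) (simp add: norm_mult)
      then show ?thesis using abs_Re_le_cmod[of "\<phi> (s n * s m) - ?a k"] by simp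
    qed
    show "\<exists>N. \<forall>m\<ge>N. \<forall>n\<ge>N. hnorm H (h m - h n) < d"
    proof (intro exI allI impI)
      fix m n assume mn: "m \<ge> N" "n \<ge> N"
      have "(hnorm H (h m - h n))\<^sup>2 < d\<^sup>2"
        unfolding hnorm_diff_power2[OF h_mem h_mem] gram
        using small[OF mn(1), of m] small[OF mn(2), of n] small[OF mn(2), of m] by linarith
      then show "hnorm H (h m - h n) < d" using d by (simp add: power2_less_imp_less)
    qed
  qed
  have "e = ?b k"
  proof (rule eq_if_eq_on_disc[OF converges_toD(2)[OF e] _ on_disc_basis_fn])
    fix z :: complex assume z: "z \<in> ball 0 1"
    have "(\<lambda>n. z * s n) \<longlonglongrightarrow> 0" using tendsto_mult_left[OF s_lim, of z] by simp
    then have "(\<lambda>n. z ^ k * \<phi> (z * s n)) \<longlonglongrightarrow> z ^ k * ?a k"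
      by (intro tendsto_mult_left \<phi>_lim)
    then have "(\<lambda>n. h n z) \<longlonglongrightarrow> ?b k z"
      using z by (simp add: h_eval basis_fn_def on_disc_def mult.commute)
    with converges_to_eval[OF e, of z] show "e z = ?b k z" by (rule LIMSEQ_unique)
  qed
  with e have bk: "converges_to h (?b k)" by simp
  note bk_mem = converges_toD(2)[OF bk]
  have orth_k: "ip H (?b k) (?b l) = 0" if "l < k" for l
    using converges_to_ip_left[OF bk mem[OF that]] h_orth[OF that] by (simp add: LIMSEQ_const_iff)
  have "ip H (?b k) (h n) = ?a k" for n
    using ip_h[OF bk_mem orth_k] s[of n] by (simp add: basis_fn_def on_disc_def)
  then have "ip H (?b k) (?b k) = ?a k"
    using converges_to_ip_right[OF bk bk_mem] by (simp add: LIMSEQ_const_iff)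
  then show ?case using bk_mem orth_k by auto
qed

lemma basis_fn_mem [simp, intro]: "basis_fn \<alpha> k \<in> carr H"
  using basis_fn_mem_ip by blast

lemma ip_basis_fn:
  "ip H (basis_fn \<alpha> k) (basis_fn \<alpha> l) = (if k = l then of_real (kernel_coeff \<alpha> k) else 0)"
proof (cases "l \<le> k")
  case True
  then have "ip H (basis_fn \<alpha> k) (basis_fn \<alpha> l) = (if l = k then of_real (kernel_coeff \<alpha> k) else 0)"
    using basis_fn_mem_ip by blast
  then show ?thesis by (simp only: eq_commute[of k l])
next
  case False
  then have "ip H (basis_fn \<alpha> l) (basis_fn \<alpha> k) = (if k = l then of_real (kernel_coeff \<alpha> l) else 0)"
    using basis_fn_mem_ip[of l] by (meson nat_le_linear)
  then show ?thesis
    using ip_sym[OF basis_fn_mem basis_fn_mem, of l k] False by (simp split: if_splits)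
qed

lemma hnorm_basis_fn_power2: "(hnorm H (basis_fn \<alpha> k))\<^sup>2 = kernel_coeff \<alpha> k"
  by (simp add: hnorm_power2 ip_basis_fn)

lemma hnorm_basis_fn: "hnorm H (basis_fn \<alpha> k) = sqrt (kernel_coeff \<alpha> k)"
  by (simp add: hnorm_def ip_basis_fn)

text \<open>
  The coordinate of \<open>f\<close> along \<open>basis_fn \<alpha> k\<close>, which has squared norm \<open>kernel_coeff \<alpha> k\<close>.
\<close>

definition coeff_at :: "(complex \<Rightarrow> complex) \<Rightarrow> nat \<Rightarrow> complex" where
  "coeff_at f k = ip H f (basis_fn \<alpha> k) / of_real (kernel_coeff \<alpha> k)"

lemma ip_eq_coeff_at: "ip H f (basis_fn \<alpha> k) = coeff_at f k * of_real (kernel_coeff \<alpha> k)"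
  using kernel_coeff_pos[OF weight_pos, of k] by (simp add: coeff_at_def)

lemma coeff_at_basis_fn: "coeff_at (basis_fn \<alpha> k) l = (if k = l then 1 else 0)"
  using kernel_coeff_pos[OF weight_pos, of l] by (auto simp: coeff_at_def ip_basis_fn)

lemma coeff_at_add: "f \<in> carr H \<Longrightarrow> g \<in> carr H \<Longrightarrow> coeff_at (f + g) k = coeff_at f k + coeff_at g k"
  by (simp add: coeff_at_def ip_add_left add_divide_distrib)

lemma coeff_at_scale: "f \<in> carr H \<Longrightarrow> coeff_at (c *\<^sub>C f) k = c * coeff_at f k"
  by (simp add: coeff_at_def ip_scale_left)

lemma coeff_at_diff: "f \<in> carr H \<Longrightarrow> g \<in> carr H \<Longrightarrow> coeff_at (f - g) k = coeff_at f k - coeff_at g k"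
  by (simp add: coeff_at_def ip_diff_left diff_divide_distrib)

lemma ip_combination_basis_fn:
  assumes "finite I"
  shows "ip H (\<Sum>k\<in>I. x k *\<^sub>C basis_fn \<alpha> k) (basis_fn \<alpha> l) =
    (if l \<in> I then x l * of_real (kernel_coeff \<alpha> l) else 0)"
proof -
  have "ip H (\<Sum>k\<in>I. x k *\<^sub>C basis_fn \<alpha> k) (basis_fn \<alpha> l) =
      (\<Sum>k\<in>I. if k = l then x l * of_real (kernel_coeff \<alpha> l) else 0)"
    by (subst ip_sum_left) (auto simp: ip_scale_left ip_basis_fn intro!: sum.cong)
  then show ?thesis using assms by simp
qed

lemma hnorm_combination_power2:
  assumes "finite I"
  shows "(hnorm H (\<Sum>k\<in>I. x k *\<^sub>C basis_fn \<alpha> k))\<^sup>2 = (\<Sum>k\<in>I. (cmod (x k))\<^sup>2 * kernel_coeff \<alpha> k)"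
proof -
  let ?f = "\<Sum>k\<in>I. x k *\<^sub>C basis_fn \<alpha> k"
  have m: "?f \<in> carr H" by (intro sum_mem scale_mem basis_fn_mem)
  have "ip H ?f ?f = (\<Sum>l\<in>I. cnj (x l) * ip H ?f (basis_fn \<alpha> l))"
    using m by (subst ip_sum_right) (auto simp: ip_scale_right)
  also have "\<dots> = (\<Sum>l\<in>I. of_real ((cmod (x l))\<^sup>2 * kernel_coeff \<alpha> l))"
    by (intro sum.cong refl)
      (simp add: ip_combination_basis_fn[OF assms] complex_norm_square mult_ac del: of_real_power)
  finally show ?thesis using m by (simp add: hnorm_power2 flip: of_real_sum)
qed

text \<open>
  Riesz and Fischer: orthogonality makes the partial sums Cauchy.
\<close>

lemma synthesis:
  assumes "summable (\<lambda>k. (cmod (x k))\<^sup>2 * kernel_coeff \<alpha> k)"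
  shows "\<exists>f. converges_to (\<lambda>n. \<Sum>k<n. x k *\<^sub>C basis_fn \<alpha> k) f \<and>
    f \<in> carr H \<and> coeff_at f = x"
proof -
  let ?S = "\<lambda>n. \<Sum>k<n. x k *\<^sub>C basis_fn \<alpha> k" and ?q = "\<lambda>k. (cmod (x k))\<^sup>2 * kernel_coeff \<alpha> k"
  have mem: "?S n \<in> carr H" for n by (intro sum_mem scale_mem basis_fn_mem)
  have tail: "(hnorm H (?S n - ?S m))\<^sup>2 = (\<Sum>k\<in>{m..<n}. ?q k)" if "m \<le> n" for m n
  proof -
    have "?S n = ?S m + (\<Sum>k\<in>{m..<n}. x k *\<^sub>C basis_fn \<alpha> k)"
      using that by (subst sum.union_disjoint[symmetric]) (auto intro!: sum.cong)
    then show ?thesis using hnorm_combination_power2[of "{m..<n}" x] by simp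
  qed
  obtain f where f: "converges_to ?S f"
  proof (rule Cauchy_convergent[of ?S, OF mem])
    fix e :: real assume e: "e > 0"
    then obtain N where N: "\<And>m n. m \<ge> N \<Longrightarrow> norm (sum ?q {m..<n}) < e\<^sup>2"
      using assms[unfolded summable_Cauchy, rule_format, of "e\<^sup>2"] by auto
    have step: "hnorm H (?S n - ?S m) < e" if "m \<ge> N" "m \<le> n" for m n
    proof (rule power2_less_imp_less)
      show "(hnorm H (?S n - ?S m))\<^sup>2 < e\<^sup>2"
        unfolding tail[OF that(2)] using N[OF that(1), of n] by simp
    qed (use e in simp)
    have "hnorm H (?S m - ?S n) < e" if "m \<ge> N" "n \<ge> N" for m n
    proof (cases "n \<le> m")
      case True
      then show ?thesis using step[of n m] that by simp
    next
      case False
      then show ?thesis using step[of m n] that hnorm_minus_commute[OF mem mem, of m n] by simp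
    qed
    then show "\<exists>N. \<forall>m\<ge>N. \<forall>n\<ge>N. hnorm H (?S m - ?S n) < e" by blast
  qed
  have "coeff_at f l = x l" for l
  proof -
    have lim: "(\<lambda>n. ip H (?S n) (basis_fn \<alpha> l)) \<longlonglongrightarrow> ip H f (basis_fn \<alpha> l)"
      using f by (intro converges_to_ip_left) auto
    have ev: "\<forall>\<^sub>F n in sequentially. ip H (?S n) (basis_fn \<alpha> l) = x l * of_real (kernel_coeff \<alpha> l)"
      using eventually_gt_at_top[of l] by eventually_elim (simp add: ip_combination_basis_fn)
    have "ip H f (basis_fn \<alpha> l) = x l * of_real (kernel_coeff \<alpha> l)"
      by (rule LIMSEQ_unique[OF lim tendsto_eventually[OF ev]])
    then show ?thesis using kernel_coeff_pos[OF weight_pos, of l] by (simp add: coeff_at_def)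
  qed
  then show ?thesis using f converges_toD(2)[OF f] by (intro exI[of _ f] conjI ext)
qed

lemma synthesis_eval:
  assumes "converges_to (\<lambda>n. \<Sum>k<n. x k *\<^sub>C basis_fn \<alpha> k) f" "z \<in> ball 0 1"
  shows "(\<lambda>k. x k * (of_real (kernel_coeff \<alpha> k) * z ^ k)) sums f z"
  using converges_to_eval[OF assms(1), of z] assms(2)
  by (simp add: sums_def sum_fun_apply scaleC_fun_apply scaleC_complex_def basis_fn_def on_disc_def)

lemma Bessel:
  assumes "f \<in> carr H"
  shows "(\<Sum>k<n. (cmod (coeff_at f k))\<^sup>2 * kernel_coeff \<alpha> k) \<le> (hnorm H f)\<^sup>2"
proof -
  let ?S = "\<Sum>k<n. coeff_at f k *\<^sub>C basis_fn \<alpha> k"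
  let ?q = "\<Sum>k<n. (cmod (coeff_at f k))\<^sup>2 * kernel_coeff \<alpha> k"
  have m: "?S \<in> carr H" by (intro sum_mem scale_mem basis_fn_mem)
  have "ip H f ?S = (\<Sum>k<n. cnj (coeff_at f k) * ip H f (basis_fn \<alpha> k))"
    using assms by (subst ip_sum_right) (auto simp: ip_scale_right)
  also have "\<dots> = (\<Sum>k<n. of_real ((cmod (coeff_at f k))\<^sup>2 * kernel_coeff \<alpha> k))"
    by (intro sum.cong refl) (simp add: ip_eq_coeff_at complex_norm_square mult_ac del: of_real_power)
  finally have "Re (ip H f ?S) = ?q" by (simp flip: of_real_sum)
  moreover have "Re (ip H ?S ?S) = ?q"
    using hnorm_combination_power2[of "{..<n}" "coeff_at f"] m by (simp add: hnorm_power2)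
  ultimately have "(hnorm H (f - ?S))\<^sup>2 = (hnorm H f)\<^sup>2 - ?q"
    using hnorm_diff_power2[OF assms m] assms by (simp add: hnorm_power2)
  then show ?thesis using zero_le_power2[of "hnorm H (f - ?S)"] by linarith
qed

lemma summable_coeff_at:
  assumes "f \<in> carr H"
  shows "summable (\<lambda>k. (cmod (coeff_at f k))\<^sup>2 * kernel_coeff \<alpha> k)"
  using Bessel[OF assms] weight_pos by (intro summableI_nonneg_bounded) auto

lemma atom_deriv_summable:
  assumes "w \<in> ball 0 1"
  shows "summable (\<lambda>k. (cmod (of_real (pochhammer (real k + 1) m) * w ^ k))\<^sup>2 * kernel_coeff \<alpha> (k + m))"
proof -
  have "(cmod w)\<^sup>2 < 1" using assms by (simp add: abs_square_less_1)
  then have "summable (\<lambda>k. (pochhammer (real k + 1) m)\<^sup>2 * kernel_coeff \<alpha> (k + m) * ((cmod w)\<^sup>2) ^ k)"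
    by (intro summable_derivative_weights weight_pos) auto
  then show ?thesis
    by (simp add: norm_mult norm_power power_mult_distrib mult_ac flip: power_mult)
qed

text \<open>
  The coefficients are square-summable for the weights, so the partial sums have some limit in
  norm. Norm convergence implies pointwise convergence, and the pointwise limit is known from the
  Taylor expansion of the kernel.
\<close>

lemma atom_deriv_expansion:
  assumes w: "w \<in> ball 0 1"
  shows "converges_to
    (\<lambda>n. \<Sum>k<n. (of_real (pochhammer (real k + 1) m) * w ^ k) *\<^sub>C basis_fn \<alpha> (k + m))
    (atom_deriv \<alpha> m w)"
proof -
  define y where "y = (\<lambda>k. of_real (pochhammer (real k + 1) m) * w ^ k :: complex)"
  define x where "x = (\<lambda>l. if l < m then 0 else y (l - m))"
  have "summable (\<lambda>k. (cmod (x (k + m)))\<^sup>2 * kernel_coeff \<alpha> (k + m))"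
    using atom_deriv_summable[OF w, of m] by (simp add: x_def y_def)
  then have "summable (\<lambda>k. (cmod (x k))\<^sup>2 * kernel_coeff \<alpha> k)"
    by (simp only: summable_iff_shift[of "\<lambda>k. (cmod (x k))\<^sup>2 * kernel_coeff \<alpha> k"])
  then obtain f where f: "converges_to (\<lambda>n. \<Sum>k<n. x k *\<^sub>C basis_fn \<alpha> k) f" "f \<in> carr H"
    by (auto dest: synthesis)
  have shift: "(\<Sum>k<n + m. x k *\<^sub>C basis_fn \<alpha> k) = (\<Sum>k<n. y k *\<^sub>C basis_fn \<alpha> (k + m))" for n
    by (induction n) (simp_all add: x_def)
  have "f = atom_deriv \<alpha> m w"
  proof (rule eq_if_eq_on_disc[OF f(2)])
    fix z :: complex assume z: "z \<in> ball 0 1"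
    have s1: "(\<lambda>k. x (k + m) * (of_real (kernel_coeff \<alpha> (k + m)) * z ^ (k + m))) sums f z"
      using synthesis_eval[OF f(1) z] sums_iff_shift[of "\<lambda>k. x k * (of_real (kernel_coeff \<alpha> k) * z ^ k)" m "f z"]
      by (simp add: x_def)
    have eq: "x (k + m) * (of_real (kernel_coeff \<alpha> (k + m)) * z ^ (k + m)) =
        z ^ m * of_real (pochhammer \<alpha> m) * (of_real (kernel_coeff (\<alpha> + real m) k) * (z * w) ^ k)" for k
    proof -
      have "complex_of_real (pochhammer \<alpha> m) * of_real (kernel_coeff (\<alpha> + real m) k) =
          of_real (pochhammer (real k + 1) m) * of_real (kernel_coeff \<alpha> (k + m))"
        by (simp only: pochhammer_times_kernel_coeff flip: of_real_mult)
      then show ?thesis by (simp add: x_def y_def power_add power_mult_distrib mult_ac)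
    qed
    have s2: "(\<lambda>k. z ^ m * of_real (pochhammer \<alpha> m) * (of_real (kernel_coeff (\<alpha> + real m) k) * (z * w) ^ k))
        sums (z ^ m * of_real (pochhammer \<alpha> m) * (1 - z * w) powr (- of_real (\<alpha> + real m)))"
      by (intro sums_mult kernel_coeff_sums_mult z w)
    show "f z = atom_deriv \<alpha> m w z"
      using sums_unique2[OF s1[unfolded eq] s2] z
      by (simp only: atom_deriv_def on_disc_def if_True higher_deriv_kernel[OF z w])
  qed (auto simp: atom_deriv_def on_disc_def)
  moreover have "converges_to (\<lambda>n. \<Sum>k<n + m. x k *\<^sub>C basis_fn \<alpha> k) f"
    using f(1) LIMSEQ_ignore_initial_segment[of "\<lambda>n. hnorm H ((\<Sum>k<n. x k *\<^sub>C basis_fn \<alpha> k) - f)" 0 m]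
    by (auto simp: converges_to_def)
  ultimately show ?thesis unfolding shift y_def by simp
qed

text \<open>
  The orthogonal system is complete: a function orthogonal to every monomial is orthogonal to the
  atoms, which are norm limits of combinations of monomials, and so it vanishes at every point by
  the reproducing property.
\<close>

lemma coeff_at_eqI:
  assumes f: "f \<in> carr H" and g: "g \<in> carr H" and eq: "\<And>k. coeff_at f k = coeff_at g k"
  shows "f = g"
proof (rule eq_if_eq_on_disc[OF f _ on_disc_eq[OF g]])
  fix z :: complex assume z: "z \<in> ball 0 1"
  then have w: "cnj z \<in> ball 0 1" by simp
  have zero: "ip H (f - g) (\<Sum>k<n. (of_real (pochhammer (real k + 1) 0) * cnj z ^ k) *\<^sub>C basis_fn \<alpha> (k + 0)) = 0" for n
    using f g eq by (subst ip_sum_right) (auto simp: ip_scale_right ip_eq_coeff_at coeff_at_diff)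
  have "ip H (f - g) (atom_deriv \<alpha> 0 (cnj z)) = 0"
    using converges_to_ip_right[OF atom_deriv_expansion[OF w, of 0], of "f - g"] f g
    unfolding zero by (simp add: LIMSEQ_const_iff)
  then have "(f - g) z = 0"
    using reproducing[OF diff_mem[OF f g] w] by (simp only: atom_deriv_0 complex_cnj_cnj)
  then show "f z = g z" by (simp add: fun_diff_def)
qed

lemma expansion:
  assumes f: "f \<in> carr H"
  shows "converges_to (\<lambda>n. \<Sum>k<n. coeff_at f k *\<^sub>C basis_fn \<alpha> k) f"
proof -
  obtain g where g: "converges_to (\<lambda>n. \<Sum>k<n. coeff_at f k *\<^sub>C basis_fn \<alpha> k) g"
      and mem: "g \<in> carr H" and eq: "coeff_at g = coeff_at f"
    using synthesis[OF summable_coeff_at[OF f]] by (elim exE conjE)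
  have "f = g"
    by (rule coeff_at_eqI[OF f mem]) (simp only: eq)
  with g show ?thesis by (simp only:)
qed

lemma Parseval:
  assumes f: "f \<in> carr H"
  shows "(\<lambda>k. (cmod (coeff_at f k))\<^sup>2 * kernel_coeff \<alpha> k) sums (hnorm H f)\<^sup>2"
  using tendsto_power[OF converges_to_hnorm[OF expansion[OF f]], of 2]
  by (simp add: sums_def hnorm_combination_power2)

end

text \<open>
  The lemma \<open>synthesis\<close> supplies the image of a function, linearity holds because functions are
  determined by their coefficients, and Parseval's identity turns the bound for sequences into a
  bound for norms.
\<close>

lemma coefficient_operator:
  assumes H: "weighted_bergman \<alpha> H" and K: "weighted_bergman \<beta> K"
    and add: "\<And>x y k. \<Phi> (\<lambda>k. x k + y k) k = \<Phi> x k + \<Phi> y k"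
    and scale: "\<And>c x k. \<Phi> (\<lambda>k. c * x k) k = c * \<Phi> x k"
    and C: "0 \<le> C"
    and bound: "\<And>x s. (\<lambda>k. (cmod (x k))\<^sup>2 * kernel_coeff \<alpha> k) sums s \<Longrightarrow>
      \<exists>t. (\<lambda>k. (cmod (\<Phi> x k))\<^sup>2 * kernel_coeff \<beta> k) sums t \<and> t \<le> C\<^sup>2 * s"
  obtains A where "bounded_op H K A" and "\<And>f. f \<in> carr H \<Longrightarrow> hnorm K (A f) \<le> C * hnorm H f"
    and "\<And>f k. f \<in> carr H \<Longrightarrow>
      weighted_bergman.coeff_at \<beta> K (A f) k = \<Phi> (weighted_bergman.coeff_at \<alpha> H f) k"
proof -
  interpret H: weighted_bergman \<alpha> H by fact
  interpret K: weighted_bergman \<beta> K by fact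
  have "\<exists>g. g \<in> carr K \<and> K.coeff_at g = \<Phi> (H.coeff_at f)" if f: "f \<in> carr H" for f
    using bound[OF H.Parseval[OF f]] K.synthesis[of "\<Phi> (H.coeff_at f)"] by (metis sums_summable)
  then obtain A where A: "\<And>f. f \<in> carr H \<Longrightarrow> A f \<in> carr K"
      "\<And>f. f \<in> carr H \<Longrightarrow> K.coeff_at (A f) = \<Phi> (H.coeff_at f)"
    by metis
  have nrm: "hnorm K (A f) \<le> C * hnorm H f" if f: "f \<in> carr H" for f
  proof -
    have "(hnorm K (A f))\<^sup>2 \<le> C\<^sup>2 * (hnorm H f)\<^sup>2"
      using bound[OF H.Parseval[OF f]] K.Parseval[OF A(1)[OF f]] unfolding A(2)[OF f]
      by (metis sums_unique2)
    then have "(hnorm K (A f))\<^sup>2 \<le> (C * hnorm H f)\<^sup>2" by (simp add: power_mult_distrib)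
    then show ?thesis by (rule power2_le_imp_le) (use C f in simp)
  qed
  have "A (f + g) = A f + A g" if "f \<in> carr H" "g \<in> carr H" for f g
  proof (rule K.coeff_at_eqI)
    show "K.coeff_at (A (f + g)) k = K.coeff_at (A f + A g) k" for k
      using that A add[of "H.coeff_at f" "H.coeff_at g" k] ext[of "H.coeff_at (f + g)", OF H.coeff_at_add[OF that]]
      by (simp add: K.coeff_at_add)
  qed (use A that in auto)
  moreover have "A (c *\<^sub>C f) = c *\<^sub>C A f" if "f \<in> carr H" for c f
  proof (rule K.coeff_at_eqI)
    show "K.coeff_at (A (c *\<^sub>C f)) k = K.coeff_at (c *\<^sub>C A f) k" for k
      using that A scale[of c "H.coeff_at f" k] ext[of "H.coeff_at (c *\<^sub>C f)", OF H.coeff_at_scale[OF that]]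
      by (simp add: K.coeff_at_scale)
  qed (use A that in auto)
  ultimately have "bounded_op H K A"
    using A(1) nrm by (auto simp: bounded_op_def linear_op_def intro!: exI[of _ C])
  then show ?thesis using nrm A(2) by (intro that[of A]) auto
qed

lemma summable_if_le:
  fixes f g :: "nat \<Rightarrow> real"
  assumes "\<And>n. 0 \<le> f n" "\<And>n. f n \<le> g n" "summable g"
  shows "summable f"
  using assms(1,2) by (intro summable_comparison_test'[OF assms(3), of 0]) simp

text \<open>
  Differentiating the curve of atoms \<open>m\<close> times is a weighted shift by \<open>m\<close> on the monomials. The
  operators that carry atoms of one summand to derivatives of atoms of another one are obtained
  from this lemma with \<open>b k = pochhammer (k + 1) m\<close>.
\<close>

lemma weighted_forward_shift:
  assumes H: "weighted_bergman \<alpha> H" and K: "weighted_bergman \<beta> K"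
    and C: "0 \<le> C"
    and bound: "\<And>k. (b k)\<^sup>2 * kernel_coeff \<beta> (k + m) \<le> C\<^sup>2 * kernel_coeff \<alpha> k"
  obtains A where "bounded_op H K A"
    and "\<And>k. A (basis_fn \<alpha> k) = complex_of_real (b k) *\<^sub>C basis_fn \<beta> (k + m)"
proof -
  interpret H: weighted_bergman \<alpha> H by fact
  interpret K: weighted_bergman \<beta> K by fact
  define \<Phi> where "\<Phi> = (\<lambda>x l. if l < m then 0 else complex_of_real (b (l - m)) * x (l - m))"
  have bnd: "\<exists>t. (\<lambda>k. (cmod (\<Phi> x k))\<^sup>2 * kernel_coeff \<beta> k) sums t \<and> t \<le> C\<^sup>2 * s"
    if x: "(\<lambda>k. (cmod (x k))\<^sup>2 * kernel_coeff \<alpha> k) sums s" for x s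
  proof -
    let ?q = "\<lambda>k. (cmod (\<Phi> x k))\<^sup>2 * kernel_coeff \<beta> k"
    have le: "?q (k + m) \<le> C\<^sup>2 * ((cmod (x k))\<^sup>2 * kernel_coeff \<alpha> k)" for k
      using mult_left_mono[OF bound[of k], of "(cmod (x k))\<^sup>2"]
      by (simp add: \<Phi>_def norm_mult power_mult_distrib mult_ac)
    have Cs: "(\<lambda>k. C\<^sup>2 * ((cmod (x k))\<^sup>2 * kernel_coeff \<alpha> k)) sums (C\<^sup>2 * s)"
      using x by (rule sums_mult)
    have sm: "summable (\<lambda>k. ?q (k + m))"
      by (rule summable_if_le[OF _ le sums_summable[OF Cs]]) (simp add: K.weight_pos)
    have "(\<Sum>k. ?q (k + m)) \<le> C\<^sup>2 * s"
      unfolding sums_unique[OF Cs] by (rule suminf_le[OF le sm sums_summable[OF Cs]])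
    moreover have "?q sums (\<Sum>k. ?q (k + m))"
    proof -
      have "(\<Sum>k<m. ?q k) = 0" by (intro sum.neutral) (simp add: \<Phi>_def)
      then show ?thesis
        using iffD1[OF sums_iff_shift[of ?q m] summable_sums[OF sm]] by (simp only: add_0_right)
    qed
    ultimately show ?thesis by blast
  qed
  obtain A where A: "bounded_op H K A"
      "\<And>f k. f \<in> carr H \<Longrightarrow> K.coeff_at (A f) k = \<Phi> (H.coeff_at f) k"
    by (rule coefficient_operator[where \<Phi> = \<Phi>, OF H K _ _ C bnd])
      (auto simp: \<Phi>_def algebra_simps)
  have "A (basis_fn \<alpha> k) = complex_of_real (b k) *\<^sub>C basis_fn \<beta> (k + m)" for k
    using linear_opD(1)[OF bounded_op_linear[OF A(1)]]
    by (intro K.coeff_at_eqI) (auto simp: A(2) K.coeff_at_scale \<Phi>_def H.coeff_at_basis_fn K.coeff_at_basis_fn)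
  then show ?thesis using A(1) that by blast
qed

text \<open>
  This is the operator with \<open>B (atom \<alpha> w) = w *\<^sub>C atom \<alpha> w\<close>. It is contractive because
  the squared norms \<open>kernel_coeff \<alpha> k\<close> of the monomials increase with \<open>k\<close> when \<open>1 \<le> \<alpha>\<close>.
\<close>

lemma contractive_backward_shift:
  assumes H: "weighted_bergman \<alpha> H" and "1 \<le> \<alpha>"
  obtains B where "bounded_op H H B" and "\<And>f. f \<in> carr H \<Longrightarrow> hnorm H (B f) \<le> hnorm H f"
    and "B (basis_fn \<alpha> 0) = 0" and "\<And>k. B (basis_fn \<alpha> (Suc k)) = basis_fn \<alpha> k"
proof -
  interpret H: weighted_bergman \<alpha> H by fact
  define \<Phi> where "\<Phi> = (\<lambda>x k. x (Suc k) :: complex)"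
  have bnd: "\<exists>t. (\<lambda>k. (cmod (\<Phi> x k))\<^sup>2 * kernel_coeff \<alpha> k) sums t \<and> t \<le> 1\<^sup>2 * s"
    if x: "(\<lambda>k. (cmod (x k))\<^sup>2 * kernel_coeff \<alpha> k) sums s" for x s
  proof -
    let ?q = "\<lambda>k. (cmod (x k))\<^sup>2 * kernel_coeff \<alpha> k" and ?p = "\<lambda>k. (cmod (\<Phi> x k))\<^sup>2 * kernel_coeff \<alpha> k"
    have le: "?p k \<le> ?q (Suc k)" for k
      using kernel_coeff_mono[OF assms(2)] by (auto simp: \<Phi>_def intro: mult_left_mono)
    have sq: "(\<lambda>k. ?q (Suc k)) sums (s - ?q 0)" using x sums_Suc_iff[of ?q "s - ?q 0"] by simp
    have sm: "summable ?p"
      by (rule summable_if_le[OF _ le sums_summable[OF sq]]) (simp add: H.weight_pos)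
    have "suminf ?p \<le> s - ?q 0"
      unfolding sums_unique[OF sq] by (rule suminf_le[OF le sm sums_summable[OF sq]])
    also have "\<dots> \<le> s" using H.weight_pos by simp
    finally show ?thesis using summable_sums[OF sm] by auto
  qed
  obtain B where B: "bounded_op H H B" "\<And>f. f \<in> carr H \<Longrightarrow> hnorm H (B f) \<le> 1 * hnorm H f"
      "\<And>f k. f \<in> carr H \<Longrightarrow> H.coeff_at (B f) k = \<Phi> (H.coeff_at f) k"
    by (rule coefficient_operator[where \<Phi> = \<Phi>, OF H H _ _ _ bnd]) (auto simp: \<Phi>_def)
  note mem = linear_opD(1)[OF bounded_op_linear[OF B(1)]]
  have "B (basis_fn \<alpha> 0) = 0"
    using mem by (intro H.coeff_at_eqI)
      (auto simp: B(3) \<Phi>_def H.coeff_at_basis_fn H.coeff_at_def[of 0])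
  moreover have "B (basis_fn \<alpha> (Suc k)) = basis_fn \<alpha> k" for k
    using mem by (intro H.coeff_at_eqI) (auto simp: B(3) \<Phi>_def H.coeff_at_basis_fn)
  ultimately show ?thesis using B(1,2) that by simp
qed

section \<open>Growth estimates\<close>

lemma one_le_if_kernel_coeff_bounded_below:
  assumes "0 < \<alpha>" "0 < c" "\<And>k. c \<le> kernel_coeff \<alpha> k"
  shows "1 \<le> \<alpha>"
proof (rule ccontr)
  assume "\<not> 1 \<le> \<alpha>"
  then have neg: "\<alpha> - 1 < 0" by simp
  obtain b C where b: "0 < b" and C: "0 < C"
    and b_le: "\<And>k. b * (real k + 1) powr (\<alpha> - 1) \<le> kernel_coeff (\<alpha>) k"
    and le_C: "\<And>k. kernel_coeff (\<alpha>) k \<le> C * (real k + 1) powr (\<alpha> - 1)"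
    by (rule kernel_coeff_growth[OF assms(1)], rule that)
  have "(\<lambda>k. C * (real k + 1) powr (\<alpha> - 1)) \<longlonglongrightarrow> C * 0"
    using neg by (intro tendsto_mult_left) real_asymp
  moreover have "c \<le> C * (real k + 1) powr (\<alpha> - 1)" for k
    using assms(3)[of k] le_C[of k] by linarith
  ultimately have "c \<le> C * 0" by (intro LIMSEQ_le_const) auto
  then show False using assms(2) by simp
qed

text \<open>
  The left side of the hypothesis grows like \<open>m powr (\<alpha> + 1)\<close>, the right side like
  \<open>m powr (\<alpha> + \<Lambda> - 1)\<close>.
\<close>

lemma two_le_if_kernel_coeff_comparison:
  assumes \<alpha>: "0 < \<alpha>" and \<Lambda>: "0 < \<Lambda>" and d: "0 < d"
    and le: "\<And>m. d * (real m)\<^sup>2 * kernel_coeff \<alpha> (m + 1) \<le> kernel_coeff (\<alpha> + \<Lambda>) (2 * m)"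
  shows "2 \<le> \<Lambda>"
proof (rule ccontr)
  assume "\<not> 2 \<le> \<Lambda>"
  then have pos: "0 < 2 - \<Lambda>" by simp
  obtain c D where c: "0 < c" and D: "0 < D"
    and c_le: "\<And>k. c * (real k + 1) powr (\<alpha> - 1) \<le> kernel_coeff (\<alpha>) k"
    and le_D: "\<And>k. kernel_coeff (\<alpha>) k \<le> D * (real k + 1) powr (\<alpha> - 1)"
    by (rule kernel_coeff_growth[OF \<alpha>], rule that)
  obtain b C where b: "0 < b" and C: "0 < C"
    and b_le: "\<And>k. b * (real k + 1) powr (\<alpha> + \<Lambda> - 1) \<le> kernel_coeff (\<alpha> + \<Lambda>) k"
    and le_C: "\<And>k. kernel_coeff (\<alpha> + \<Lambda>) k \<le> C * (real k + 1) powr (\<alpha> + \<Lambda> - 1)"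
    by (rule kernel_coeff_growth[OF add_pos_pos[OF \<alpha> \<Lambda>]], rule that)
  let ?r = "\<lambda>m. ((real m + 2) / (2 * real m + 1)) powr (\<alpha> - 1)"
  let ?s = "\<lambda>m. (real m)\<^sup>2 / (2 * real m + 1) powr \<Lambda>"
  have bound: "?r m * ?s m \<le> C / (d * c)" for m
  proof -
    have "(d * (real m)\<^sup>2) * (c * (real (m + 1) + 1) powr (\<alpha> - 1))
        \<le> (d * (real m)\<^sup>2) * kernel_coeff \<alpha> (m + 1)"
      using d by (intro mult_left_mono c_le) auto
    also have "\<dots> \<le> C * (real (2 * m) + 1) powr (\<alpha> + \<Lambda> - 1)"
      using le[of m] le_C[of "2 * m"] by linarith
    also have "(real (2 * m) + 1) powr (\<alpha> + \<Lambda> - 1) =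
        (2 * real m + 1) powr (\<alpha> - 1) * (2 * real m + 1) powr \<Lambda>"
      by (simp add: powr_add[symmetric] algebra_simps)
    finally show ?thesis
      using c d by (simp add: powr_divide field_simps)
  qed
  have "?r \<longlonglongrightarrow> (1 / 2) powr (\<alpha> - 1)"
    by (intro tendsto_powr tendsto_const) (real_asymp | simp)+
  moreover have "filterlim ?s at_top sequentially" using pos \<Lambda> by real_asymp
  ultimately have "filterlim (\<lambda>m. ?r m * ?s m) at_top sequentially"
    by (intro filterlim_tendsto_pos_mult_at_top) auto
  then have "\<forall>\<^sub>F m in sequentially. C / (d * c) < ?r m * ?s m"
    by (simp add: filterlim_at_top_dense)
  then obtain m where "C / (d * c) < ?r m * ?s m"
    using eventually_happens trivial_limit_sequentially by blast
  then show False using bound[of m] by linarith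
qed

text \<open>
  The left side has order \<open>k powr (2 * m + \<alpha> - 1)\<close> and the right side \<open>k powr (\<beta> - 1)\<close>.
\<close>

lemma derivative_shift_bound:
  assumes \<alpha>: "1 \<le> \<alpha>" and \<beta>: "\<alpha> + 2 * real m \<le> \<beta>"
  obtains C where "0 \<le> C"
    and "\<And>k. (pochhammer (real k + 1) m)\<^sup>2 * kernel_coeff \<alpha> (k + m) \<le> C\<^sup>2 * kernel_coeff \<beta> k"
proof -
  have pos: "0 < \<alpha>" "0 < \<beta>" using assms by auto
  obtain b D where b: "0 < b" and D: "0 < D"
    and b_le: "\<And>k. b * (real k + 1) powr (\<alpha> - 1) \<le> kernel_coeff (\<alpha>) k"
    and le_D: "\<And>k. kernel_coeff (\<alpha>) k \<le> D * (real k + 1) powr (\<alpha> - 1)"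
    by (rule kernel_coeff_growth[OF pos(1)], rule that)
  obtain c C where c: "0 < c" and C: "0 < C"
    and c_le: "\<And>k. c * (real k + 1) powr (\<beta> - 1) \<le> kernel_coeff (\<beta>) k"
    and le_C: "\<And>k. kernel_coeff (\<beta>) k \<le> C * (real k + 1) powr (\<beta> - 1)"
    by (rule kernel_coeff_growth[OF pos(2)], rule that)
  define M where "M = real m + 1"
  define C2 where "C2 = M ^ (2 * m) * D * M powr (\<alpha> - 1) / c"
  have "(pochhammer (real k + 1) m)\<^sup>2 * kernel_coeff \<alpha> (k + m) \<le> C2 * kernel_coeff \<beta> k" for k
  proof -
    let ?x = "real k + 1"
    have Mx: "real k + 1 + real m \<le> M * ?x" by (simp add: M_def algebra_simps)
    have "pochhammer ?x m = (\<Prod>i<m. ?x + real i)" by (simp add: pochhammer_prod lessThan_atLeast0)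
    also have "\<dots> \<le> (\<Prod>i<m. M * ?x)"
      using Mx by (intro prod_mono) auto
    finally have "(pochhammer ?x m)\<^sup>2 \<le> ((M * ?x) ^ m)\<^sup>2"
      by (intro power_mono) (simp_all add: pochhammer_nonneg)
    also have "\<dots> = M ^ (2 * m) * ?x powr (2 * real m)"
      using powr_realpow[of ?x "2 * m"]
      by (simp add: power_mult_distrib power_mult[symmetric] mult.commute)
    finally have 1: "(pochhammer ?x m)\<^sup>2 \<le> M ^ (2 * m) * ?x powr (2 * real m)" .
    have "kernel_coeff \<alpha> (k + m) \<le> D * (real (k + m) + 1) powr (\<alpha> - 1)" by (rule le_D)
    also have "\<dots> \<le> D * (M * ?x) powr (\<alpha> - 1)"
      using D Mx \<alpha> by (intro mult_left_mono powr_mono2) auto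
    finally have 2: "kernel_coeff \<alpha> (k + m) \<le> D * (M powr (\<alpha> - 1) * ?x powr (\<alpha> - 1))"
      by (simp add: powr_mult M_def)
    have "(pochhammer ?x m)\<^sup>2 * kernel_coeff \<alpha> (k + m)
        \<le> (M ^ (2 * m) * ?x powr (2 * real m)) * (D * (M powr (\<alpha> - 1) * ?x powr (\<alpha> - 1)))"
      using 1 2 pos by (intro mult_mono) (auto simp: M_def)
    also have "\<dots> = (C2 * c) * ?x powr (2 * real m + (\<alpha> - 1))"
      using c by (simp add: C2_def powr_add)
    also have "\<dots> \<le> (C2 * c) * ?x powr (\<beta> - 1)"
      using \<beta> c D by (intro mult_left_mono powr_mono) (auto simp: C2_def M_def)
    also have "\<dots> = C2 * (c * ?x powr (\<beta> - 1))" by simp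
    also have "\<dots> \<le> C2 * kernel_coeff \<beta> k"
      using c_le[of k] c D by (intro mult_left_mono) (auto simp: C2_def M_def)
    finally show ?thesis .
  qed
  moreover have "0 \<le> C2" using c D by (simp add: C2_def M_def)
  ultimately show ?thesis by (intro that[of "sqrt C2"]) auto
qed

text \<open>
  The first nonzero coefficient of the difference would be the limit at 0 of a function that
  vanishes in the punctured disc.
\<close>

lemma powser_coeff_unique:
  fixes c d :: "nat \<Rightarrow> complex"
  assumes c: "\<And>w. cmod w < 1 \<Longrightarrow> (\<lambda>k. c k * w ^ k) sums F w"
    and d: "\<And>w. cmod w < 1 \<Longrightarrow> (\<lambda>k. d k * w ^ k) sums F w"
  shows "c k = d k"
proof -
  define e where "e = (\<lambda>k. c k - d k)"
  have e: "(\<lambda>k. e k * w ^ k) sums 0" if "cmod w < 1" for w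
    using sums_diff[OF c[OF that] d[OF that]] by (simp add: e_def algebra_simps)
  have "e k = 0"
  proof (induction k rule: less_induct)
    case (less k)
    have tail: "(\<lambda>i. e (i + k) * w ^ i) sums 0" if w: "w \<noteq> 0" "cmod w < 1" for w
    proof -
      have "(\<Sum>i<k. e i * w ^ i) = 0" using less by simp
      then have "(\<lambda>i. e (i + k) * w ^ (i + k)) sums 0"
        using sums_split_initial_segment[OF e[OF w(2)], of k] by simp
      then have "(\<lambda>i. inverse (w ^ k) * (e (i + k) * w ^ (i + k))) sums (inverse (w ^ k) * 0)"
        by (rule sums_mult)
      moreover have "inverse (w ^ k) * (e (i + k) * w ^ (i + k)) = e (i + k) * w ^ i" for i
        using w(1) by (simp add: power_add)
      ultimately show ?thesis by simp
    qed
    have "((\<lambda>w. 0) \<longlongrightarrow> e (0 + k)) (at (0::complex))"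
      by (rule powser_limit_0_strong[of 1]) (use tail in auto)
    then have "e (0 + k) = 0" by (rule LIM_const_eq[symmetric])
    then show "e k = 0" by simp
  qed
  then show ?thesis by (simp add: e_def)
qed

section \<open>Finite direct sums\<close>

lemma embed_add: "embed i (x + y) = embed i x + embed i (y :: 'a::complex_vector)"
  by (auto simp: embed_def plus_fun_def)

lemma embed_scale: "embed i (c *\<^sub>C x) = c *\<^sub>C embed i (x :: 'a::complex_vector)"
  by (auto simp: embed_def scaleC_fun_def)

lemma embed_zero [simp]: "embed i (0 :: 'a::complex_vector) = 0"
  by (auto simp: embed_def zero_fun_def)

lemma embed_sum: "embed i (\<Sum>k\<in>I. X k) = (\<Sum>k\<in>I. embed i (X k :: 'a::complex_vector))"
  by (induction I rule: infinite_finite_induct) (simp_all add: embed_add)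

lemma embed_apply: "embed i x k = (if k = i then x else 0)"
  by (simp add: embed_def)

locale direct_sum_space =
  fixes n :: nat and \<H> :: "nat \<Rightarrow> 'a::complex_vector hspace"
  assumes summand: "i < n \<Longrightarrow> inner_space (\<H> i)"
begin

abbreviation DS where "DS \<equiv> direct_sum n \<H>"

lemma mem_iff: "f \<in> carr DS \<longleftrightarrow> (\<forall>i<n. f i \<in> carr (\<H> i)) \<and> (\<forall>i\<ge>n. f i = 0)"
  by (simp add: direct_sum_def)

lemma ip_DS: "ip DS f g = (\<Sum>i<n. ip (\<H> i) (f i) (g i))"
  by (simp add: direct_sum_def)

lemma inner_space_DS: "inner_space DS"
proof
  show "inner_product_space DS"
    unfolding inner_product_space_def
  proof (intro conjI ballI allI impI)
    show "complex_vector.subspace (carr DS)"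
      using inner_space.zero_mem[OF summand] inner_space.add_mem[OF summand]
        inner_space.scale_mem[OF summand]
      by (auto simp: complex_vector.subspace_def mem_iff zero_fun_def plus_fun_def scaleC_fun_def)
  next
    fix x y z assume "x \<in> carr DS" "y \<in> carr DS" "z \<in> carr DS"
    then show "ip DS (x + y) z = ip DS x z + ip DS y z"
      by (simp add: ip_DS mem_iff plus_fun_def sum.distrib inner_space.ip_add_left[OF summand])
  next
    fix c x y assume "x \<in> carr DS" "y \<in> carr DS"
    then show "ip DS (c *\<^sub>C x) y = c * ip DS x y"
      by (simp add: ip_DS mem_iff scaleC_fun_def sum_distrib_left inner_space.ip_scale_left[OF summand])
  next
    fix x y assume "x \<in> carr DS" "y \<in> carr DS"
    then have "ip (\<H> i) (y i) (x i) = cnj (ip (\<H> i) (x i) (y i))" if "i < n" for i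
      using that by (intro inner_space.ip_sym[OF summand]) (auto simp: mem_iff)
    then show "ip DS y x = cnj (ip DS x y)" by (simp add: ip_DS)
  next
    fix x assume x: "x \<in> carr DS" "x \<noteq> 0"
    then obtain i where "x i \<noteq> 0" by (auto simp: zero_fun_def)
    with x have i: "i < n" "x i \<noteq> 0" by (auto simp: mem_iff not_less[symmetric])
    show "0 < Re (ip DS x x)"
      unfolding ip_DS Re_sum
    proof (rule sum_pos2[of _ i])
      show "0 < Re (ip (\<H> i) (x i) (x i))"
        using x i by (intro inner_space.ip_pos[OF summand]) (auto simp: mem_iff)
      show "0 \<le> Re (ip (\<H> j) (x j) (x j))" if "j \<in> {..<n}" for j
        using x that by (intro inner_space.ip_self_nonneg[OF summand]) (auto simp: mem_iff)
    qed (use i in auto)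
  qed
qed

sublocale DS: inner_space DS
  by (rule inner_space_DS)

lemma hnorm_DS_power2:
  assumes "f \<in> carr DS"
  shows "(hnorm DS f)\<^sup>2 = (\<Sum>i<n. (hnorm (\<H> i) (f i))\<^sup>2)"
  using assms inner_space.hnorm_power2[OF summand]
  by (simp add: DS.hnorm_power2 mem_iff ip_DS)

lemma bounded_op_embed:
  assumes i: "i < n"
  shows "bounded_op (\<H> i) DS (embed i)"
proof -
  interpret H: inner_space "\<H> i" by (rule summand[OF i])
  have mem: "embed i x \<in> carr DS" if "x \<in> carr (\<H> i)" for x
    using that i inner_space.zero_mem[OF summand] by (auto simp: mem_iff embed_apply)
  have "hnorm DS (embed i x) = hnorm (\<H> i) x" if x: "x \<in> carr (\<H> i)" for x
  proof -
    have "ip DS (embed i x) (embed i x) = (\<Sum>k<n. if k = i then ip (\<H> i) x x else 0)"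
      unfolding ip_DS
      by (intro sum.cong refl) (auto simp: embed_apply inner_space.ip_zero_left[OF summand]
          inner_space.zero_mem[OF summand])
    also have "\<dots> = ip (\<H> i) x x" using i by simp
    finally show ?thesis by (simp add: hnorm_def)
  qed
  then show ?thesis using mem
    by (auto simp: bounded_op_def linear_op_def embed_add embed_scale intro!: exI[of _ 1])
qed

lemma embed_mem: "i < n \<Longrightarrow> x \<in> carr (\<H> i) \<Longrightarrow> embed i x \<in> carr DS"
  using linear_opD(1)[OF bounded_op_linear[OF bounded_op_embed]] .

lemma hnorm_component_le:
  assumes "f \<in> carr DS" "i < n"
  shows "hnorm (\<H> i) (f i) \<le> hnorm DS f"
proof -
  have "(hnorm (\<H> i) (f i))\<^sup>2 \<le> (hnorm DS f)\<^sup>2"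
    unfolding hnorm_DS_power2[OF assms(1)]
    using assms(2) by (intro member_le_sum) auto
  then show ?thesis by (rule power2_le_imp_le) (use assms in simp)
qed

lemma bounded_op_component:
  assumes "i < n"
  shows "bounded_op DS (\<H> i) (\<lambda>f. f i)"
  using assms hnorm_component_le[OF _ assms]
  by (auto simp: bounded_op_def linear_op_def mem_iff plus_fun_def scaleC_fun_def intro!: exI[of _ 1])

lemma eq_sum_embed:
  assumes "f \<in> carr DS"
  shows "f = (\<Sum>i<n. embed i (f i))"
proof
  fix k
  show "f k = (\<Sum>i<n. embed i (f i)) k"
  proof (cases "k < n")
    case True
    then have "(\<Sum>i<n. if k = i then f i else 0) = f k" by simp
    then show ?thesis by (simp only: sum_fun_apply embed_apply)
  next
    case False
    then have "(\<Sum>i<n. if k = i then f i else 0) = 0" by (intro sum.neutral) auto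
    then show ?thesis using assms False by (simp only: sum_fun_apply embed_apply mem_iff not_less)
  qed
qed

end

section \<open>The operator in the monomial basis\<close>

text \<open>
  Since \<open>basis_fn\<close> is total in its space, bounded operators are determined by their values on it.
\<close>

lemma (in weighted_bergman) bounded_ops_eqI:
  assumes A: "bounded_op H K A" and B: "bounded_op H K B" and K: "inner_space K"
    and eq: "\<And>k. A (basis_fn \<alpha> k) = B (basis_fn \<alpha> k)" and f: "f \<in> carr H"
  shows "A f = B f"
proof -
  interpret K: inner_space K by fact
  let ?S = "\<lambda>n. \<Sum>k<n. coeff_at f k *\<^sub>C basis_fn \<alpha> k"
  have lin: "L (?S n) = (\<Sum>k<n. coeff_at f k *\<^sub>C L (basis_fn \<alpha> k))" if "linear_op H K L" for L n
    using linear_op_sum[OF that inner_space_axioms, of "{..<n}" "\<lambda>k. coeff_at f k *\<^sub>C basis_fn \<alpha> k"]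
    by (simp add: linear_opD(3)[OF that])
  have S: "A (?S n) = B (?S n)" for n
    unfolding lin[OF bounded_op_linear[OF A]] lin[OF bounded_op_linear[OF B]] eq ..
  show ?thesis
    using bounded_op_converges_to[OF A inner_space_axioms K expansion[OF f]]
      bounded_op_converges_to[OF B inner_space_axioms K expansion[OF f]]
    unfolding S by (rule K.converges_to_unique)
qed

locale quasi_homogeneous_model =
  fixes n :: nat and \<alpha>\<^sub>0 \<Lambda> :: real and \<mu> :: "nat \<Rightarrow> nat \<Rightarrow> complex"
    and \<H> :: "nat \<Rightarrow> (complex \<Rightarrow> complex) hspace"
    and T :: "(nat \<Rightarrow> complex \<Rightarrow> complex) \<Rightarrow> (nat \<Rightarrow> complex \<Rightarrow> complex)"
  assumes model: "model_operator n \<alpha>\<^sub>0 \<Lambda> \<mu> \<H> T"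
begin

definition weight :: "nat \<Rightarrow> real" where
  "weight i = \<alpha>\<^sub>0 + of_nat i * \<Lambda>"

lemma two_le_n: "2 \<le> n" and \<alpha>\<^sub>0_pos: "0 < \<alpha>\<^sub>0" and \<Lambda>_pos: "0 < \<Lambda>"
  and \<mu>_diag: "i < n \<Longrightarrow> \<mu> i i = 1" and \<mu>_01: "\<mu> 0 1 \<noteq> 0"
  and T_frame: "w \<in> ball 0 1 \<Longrightarrow> j < n \<Longrightarrow> T (frame weight \<mu> j w) = w *\<^sub>C frame weight \<mu> j w"
  and T_bounded: "bounded_op (direct_sum n \<H>) (direct_sum n \<H>) T"
  using model by (auto simp: model_operator_def Cowen_Douglas_def weight_def[abs_def])

lemma weight_0: "weight 0 = \<alpha>\<^sub>0" and weight_1: "weight 1 = \<alpha>\<^sub>0 + \<Lambda>"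
  by (simp_all add: weight_def)

lemma weight_pos: "0 < weight i"
  using \<alpha>\<^sub>0_pos \<Lambda>_pos by (simp add: weight_def add_pos_nonneg)

lemma bergman: "i < n \<Longrightarrow> weighted_bergman (weight i) (\<H> i)"
  using model weight_pos by (simp add: weighted_bergman_def model_operator_def weight_def)

lemma inner_space_\<H>: "i < n \<Longrightarrow> inner_space (\<H> i)"
  using bergman[of i]
  by (simp add: weighted_bergman_def is_weighted_bergman_def hilbert_space_def inner_space_def)

end

sublocale quasi_homogeneous_model \<subseteq> direct_sum_space n \<H>
  by unfold_locales (rule inner_space_\<H>[unfolded inner_space_def])

context quasi_homogeneous_model
begin

lemma T_mem: "f \<in> carr DS \<Longrightarrow> T f \<in> carr DS"
  using linear_opD(1)[OF bounded_op_linear[OF T_bounded]] .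

definition basis_vec :: "nat \<Rightarrow> nat \<Rightarrow> nat \<Rightarrow> complex \<Rightarrow> complex" where
  "basis_vec i k = embed i (basis_fn (weight i) k)"

text \<open>
  The \<open>k\<close>-th Taylor coefficient at 0 of the curve \<open>w \<mapsto> frame weight \<mu> j w\<close>.
\<close>

definition frame_coeff :: "nat \<Rightarrow> nat \<Rightarrow> nat \<Rightarrow> complex \<Rightarrow> complex" where
  "frame_coeff j k =
    (\<Sum>i\<le>j. (\<mu> i j * of_real (pochhammer (real k + 1) (j - i))) *\<^sub>C basis_vec i (k + (j - i)))"

lemma basis_vec_mem: "i < n \<Longrightarrow> basis_vec i k \<in> carr DS"
  unfolding basis_vec_def by (intro embed_mem weighted_bergman.basis_fn_mem bergman)

lemma frame_coeff_mem: "j < n \<Longrightarrow> frame_coeff j k \<in> carr DS"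
  unfolding frame_coeff_def by (intro DS.sum_mem DS.scale_mem basis_vec_mem) auto

lemma frame_expansion:
  assumes w: "w \<in> ball 0 1" and j: "j < n"
  shows "DS.converges_to (\<lambda>N. \<Sum>k<N. w ^ k *\<^sub>C frame_coeff j k) (frame weight \<mu> j w)"
proof -
  have conv: "DS.converges_to
      (\<lambda>N. embed i (\<mu> i j *\<^sub>C (\<Sum>k<N. (of_real (pochhammer (real k + 1) (j - i)) * w ^ k) *\<^sub>C
        basis_fn (weight i) (k + (j - i)))))
      (embed i (\<mu> i j *\<^sub>C atom_deriv (weight i) (j - i) w))" if "i \<in> {..j}" for i
  proof -
    have i: "i < n" using that j by simp
    interpret B: weighted_bergman "weight i" "\<H> i" by (rule bergman[OF i])
    show ?thesis
      by (intro bounded_op_converges_to[OF bounded_op_embed[OF i] inner_space_\<H>[OF i] inner_space_DS]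
          B.converges_to_scale B.atom_deriv_expansion w)
  qed
  have "(\<Sum>i\<le>j. embed i (\<mu> i j *\<^sub>C (\<Sum>k<N. (of_real (pochhammer (real k + 1) (j - i)) * w ^ k) *\<^sub>C
        basis_fn (weight i) (k + (j - i))))) = (\<Sum>k<N. w ^ k *\<^sub>C frame_coeff j k)" for N
  proof -
    have "embed i (\<mu> i j *\<^sub>C (\<Sum>k<N. (of_real (pochhammer (real k + 1) (j - i)) * w ^ k) *\<^sub>C
        basis_fn (weight i) (k + (j - i)))) =
      (\<Sum>k<N. w ^ k *\<^sub>C (\<mu> i j * of_real (pochhammer (real k + 1) (j - i))) *\<^sub>C basis_vec i (k + (j - i)))" for i
      unfolding basis_vec_def complex_vector.scale_sum_right embed_sum embed_scale scaleC_scaleC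
      by (intro sum.cong refl) (simp only: mult_ac)
    then show ?thesis
      unfolding frame_coeff_def complex_vector.scale_sum_right by (simp only: sum.swap[of _ "{..j}"])
  qed
  moreover have "DS.converges_to (\<lambda>N. \<Sum>i\<le>j. embed i (\<mu> i j *\<^sub>C (\<Sum>k<N. (of_real (pochhammer (real k + 1) (j - i)) * w ^ k) *\<^sub>C
        basis_fn (weight i) (k + (j - i)))))
      (frame weight \<mu> j w)"
    unfolding frame_def by (intro DS.converges_to_sum conv)
  ultimately show ?thesis by (simp only:)
qed

lemma evaluation_converges:
  assumes "DS.converges_to X f" "i < n"
  shows "(\<lambda>N. X N i z) \<longlonglongrightarrow> f i z"
proof -
  interpret B: weighted_bergman "weight i" "\<H> i" by (rule bergman[OF assms(2)])
  show ?thesis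
    by (rule B.converges_to_eval[OF bounded_op_converges_to[OF bounded_op_component[OF assms(2)]
            inner_space_DS inner_space_\<H>[OF assms(2)] assms(1)]])
qed

text \<open>
  Applying \<open>T\<close> to the expansion of the frame and comparing the coefficients of the powers of
  \<open>w\<close> in \<open>T (frame weight \<mu> j w) = w *\<^sub>C frame weight \<mu> j w\<close> shows that \<open>T\<close> lowers the index of
  the vectors \<open>frame_coeff j k\<close>.  Evaluations reduce the comparison to scalar power series.
\<close>

lemma T_frame_coeff:
  assumes j: "j < n"
  shows "T (frame_coeff j k) = (case k of 0 \<Rightarrow> 0 | Suc l \<Rightarrow> frame_coeff j l)"
proof (rule ext, rule ext)
  fix i z
  let ?r = "\<lambda>k. (case k of 0 \<Rightarrow> 0 | Suc l \<Rightarrow> frame_coeff j l) :: nat \<Rightarrow> complex \<Rightarrow> complex"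
  show "T (frame_coeff j k) i z = ?r k i z"
  proof (cases "i < n")
    case i: True
    show ?thesis
    proof (rule powser_coeff_unique[where c = "\<lambda>k. T (frame_coeff j k) i z" and d = "\<lambda>k. ?r k i z"])
      fix w :: complex assume "cmod w < 1"
      then have w: "w \<in> ball 0 1" by simp
      note lT = bounded_op_linear[OF T_bounded]
      note expn = frame_expansion[OF w j]
      have T_sum: "T (\<Sum>k<N. w ^ k *\<^sub>C frame_coeff j k) = (\<Sum>k<N. w ^ k *\<^sub>C T (frame_coeff j k))" for N
        using linear_op_sum[OF lT inner_space_DS, of "{..<N}" "\<lambda>k. w ^ k *\<^sub>C frame_coeff j k"]
        by (simp add: linear_opD(3)[OF lT] frame_coeff_mem[OF j] DS.scale_mem)
      have apply_sum: "(\<Sum>k<N. w ^ k *\<^sub>C v k) i z = (\<Sum>k<N. v k i z * w ^ k)"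
        for N and v :: "nat \<Rightarrow> nat \<Rightarrow> complex \<Rightarrow> complex"
        by (simp only: sum_fun_apply scaleC_fun_apply scaleC_complex_def mult.commute)
      have "(\<lambda>N. T (\<Sum>k<N. w ^ k *\<^sub>C frame_coeff j k) i z) \<longlonglongrightarrow> T (frame weight \<mu> j w) i z"
        by (rule evaluation_converges[OF
              bounded_op_converges_to[OF T_bounded inner_space_DS inner_space_DS expn] i])
      then show "(\<lambda>k. T (frame_coeff j k) i z * w ^ k) sums (w * frame weight \<mu> j w i z)"
        by (simp only: T_sum apply_sum T_frame[OF w j] scaleC_fun_apply scaleC_complex_def sums_def)
      have "(\<lambda>k. frame_coeff j k i z * w ^ k) sums frame weight \<mu> j w i z"
        using evaluation_converges[OF expn i, of z] by (simp only: apply_sum sums_def)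
      then have "(\<lambda>k. w * (frame_coeff j k i z * w ^ k)) sums (w * frame weight \<mu> j w i z)"
        by (rule sums_mult)
      then have "(\<lambda>k. ?r (Suc k) i z * w ^ Suc k) sums (w * frame weight \<mu> j w i z)"
        by (simp add: mult_ac)
      then show "(\<lambda>k. ?r k i z * w ^ k) sums (w * frame weight \<mu> j w i z)"
        using sums_Suc[of "\<lambda>k. ?r k i z * w ^ k"] by (simp add: zero_fun_def)
    qed
  next
    case False
    have zero: "f i = 0" if "f \<in> carr DS" for f using that False by (simp add: mem_iff)
    have "?r k \<in> carr DS" using frame_coeff_mem[OF j] by (cases k) auto
    then show ?thesis using zero[OF T_mem[OF frame_coeff_mem[OF j]]] zero by simp
  qed
qed

lemma T_power_frame_coeff:
  assumes "j < n"
  shows "(T ^^ m) (frame_coeff j (k + m)) = frame_coeff j k"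
  by (induction m) (simp_all add: T_frame_coeff[OF assms] funpow_swap1)

lemma frame_coeff_0: "frame_coeff 0 k = basis_vec 0 k"
  using two_le_n \<mu>_diag[of 0] by (simp add: frame_coeff_def scaleC_one)

lemma frame_coeff_1:
  "frame_coeff 1 k = basis_vec 1 k + (\<mu> 0 1 * of_real (real k + 1)) *\<^sub>C basis_vec 0 (k + 1)"
  using two_le_n \<mu>_diag[of 1] by (simp add: frame_coeff_def scaleC_one add.commute)

lemma hnorm_basis_vec: "i < n \<Longrightarrow> hnorm DS (basis_vec i k) = sqrt (kernel_coeff (weight i) k)"
proof -
  assume i: "i < n"
  interpret B: weighted_bergman "weight i" "\<H> i" by (rule bergman[OF i])
  have "(hnorm DS (basis_vec i k))\<^sup>2 = (\<Sum>l<n. if l = i then kernel_coeff (weight i) k else 0)"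
    unfolding hnorm_DS_power2[OF basis_vec_mem[OF i]] unfolding basis_vec_def
    by (intro sum.cong refl)
      (auto simp: embed_apply B.hnorm_basis_fn_power2 inner_space.hnorm_zero[OF summand])
  also have "\<dots> = kernel_coeff (weight i) k" using i by simp
  finally show ?thesis
    using basis_vec_mem[OF i] by (metis DS.hnorm_nonneg real_sqrt_abs abs_of_nonneg)
qed

subsection \<open>Power boundedness forces the weights to grow\<close>

context
  fixes M :: real
  assumes M: "\<And>m f. f \<in> carr DS \<Longrightarrow> hnorm DS ((T ^^ m) f) \<le> M * hnorm DS f"
begin

text \<open>
  \<open>T ^^ m\<close> maps the monomial of degree \<open>m\<close> in the first summand to the one of degree 0, so the
  norms of the monomials stay away from zero.
\<close>

lemma one_le_weight: "1 \<le> \<alpha>\<^sub>0"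
proof -
  have n: "0 < n" using two_le_n by simp
  have le: "1 \<le> M * sqrt (kernel_coeff \<alpha>\<^sub>0 m)" for m
  proof -
    have "(T ^^ m) (basis_vec 0 (0 + m)) = basis_vec 0 0"
      using T_power_frame_coeff[OF n, of m 0] by (simp only: frame_coeff_0)
    then show ?thesis
      using M[OF basis_vec_mem[OF n], of m "0 + m"] n by (simp add: hnorm_basis_vec weight_0)
  qed
  have Mpos: "1 \<le> M" using le[of 0] by simp
  have "1 / M\<^sup>2 \<le> kernel_coeff \<alpha>\<^sub>0 m" for m
  proof -
    have "1\<^sup>2 \<le> (M * sqrt (kernel_coeff \<alpha>\<^sub>0 m))\<^sup>2" using le[of m] by (intro power_mono) auto
    also have "\<dots> = M\<^sup>2 * kernel_coeff \<alpha>\<^sub>0 m" using \<alpha>\<^sub>0_pos by (simp add: power_mult_distrib)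
    finally show ?thesis using Mpos by (simp add: divide_le_eq mult.commute)
  qed
  then show ?thesis
    using one_le_if_kernel_coeff_bounded_below[OF \<alpha>\<^sub>0_pos, of "1 / M\<^sup>2"] Mpos by simp
qed

text \<open>
  The entry of \<open>T ^^ m\<close> from the second to the first summand carries the factor \<open>m\<close>, as in a
  power of a Jordan block: it comes from \<open>(k + 1) - (k + m + 1)\<close>, the difference of the weights
  of \<open>basis_vec 0\<close> in \<open>frame_coeff 1 k\<close> and in \<open>frame_coeff 1 (k + m)\<close>.
\<close>

lemma T_power_basis_vec_1:
  "(T ^^ m) (basis_vec 1 (k + m)) = basis_vec 1 k + (- (\<mu> 0 1 * of_nat m)) *\<^sub>C basis_vec 0 (k + 1)"
proof -
  have n: "0 < n" "1 < n" using two_le_n by auto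
  note lT = bounded_op_linear[OF bounded_op_power[OF T_bounded inner_space_DS], of m]
  let ?c = "\<mu> 0 1 * of_real (real (k + m) + 1)"
  have idx: "k + m + 1 = (k + 1) + m" by simp
  have "basis_vec 1 (k + m) = frame_coeff 1 (k + m) + (- ?c) *\<^sub>C frame_coeff 0 ((k + 1) + m)"
    unfolding frame_coeff_1 frame_coeff_0 idx by simp
  then have "(T ^^ m) (basis_vec 1 (k + m)) =
      (T ^^ m) (frame_coeff 1 (k + m)) + (- ?c) *\<^sub>C (T ^^ m) (frame_coeff 0 ((k + 1) + m))"
    using n frame_coeff_mem by (simp only: linear_opD(2,3)[OF lT] DS.scale_mem)
  also have "\<dots> = frame_coeff 1 k + (- ?c) *\<^sub>C frame_coeff 0 (k + 1)"
    using n by (simp only: T_power_frame_coeff)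
  also have "\<dots> = basis_vec 1 k + (\<mu> 0 1 * of_real (real k + 1) + (- ?c)) *\<^sub>C basis_vec 0 (k + 1)"
    by (simp only: frame_coeff_1 frame_coeff_0 scaleC_add_left add.assoc)
  also have "\<mu> 0 1 * of_real (real k + 1) + (- ?c) = - (\<mu> 0 1 * of_nat m)"
    by (simp add: algebra_simps)
  finally show ?thesis .
qed

text \<open>
  Along the monomials of degree \<open>2 * m\<close> in the second summand, divided by their norms, the entry
  of \<open>T ^^ m\<close> computed above has norm of order \<open>m * m powr (- \<Lambda> / 2)\<close>. This is bounded only
  if \<open>2 \<le> \<Lambda>\<close>.
\<close>

lemma two_le_valency: "2 \<le> \<Lambda>"
proof -
  have n: "0 < n" "1 < n" using two_le_n by auto
  interpret B: weighted_bergman \<alpha>\<^sub>0 "\<H> 0" using bergman[OF n(1)] by (simp add: weight_0)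
  have le: "cmod (\<mu> 0 1) * real m * sqrt (kernel_coeff \<alpha>\<^sub>0 (m + 1)) \<le>
      M * sqrt (kernel_coeff (\<alpha>\<^sub>0 + \<Lambda>) (2 * m))" for m
  proof -
    let ?v = "(T ^^ m) (basis_vec 1 (m + m))"
    have "?v 0 = (- (\<mu> 0 1 * of_nat m)) *\<^sub>C basis_fn \<alpha>\<^sub>0 (m + 1)"
      unfolding T_power_basis_vec_1
      by (simp add: plus_fun_def scaleC_fun_def basis_vec_def embed_apply weight_0 zero_fun_def)
    then have "cmod (\<mu> 0 1) * real m * sqrt (kernel_coeff \<alpha>\<^sub>0 (m + 1)) = hnorm (\<H> 0) (?v 0)"
      by (simp only: B.hnorm_scale[OF B.basis_fn_mem] B.hnorm_basis_fn norm_minus_cancel norm_mult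
          norm_of_nat)
    also have "\<dots> \<le> hnorm DS ?v"
      using linear_opD(1)[OF bounded_op_linear[OF bounded_op_power[OF T_bounded inner_space_DS]]]
        basis_vec_mem n by (intro hnorm_component_le) auto
    also have "\<dots> \<le> M * sqrt (kernel_coeff (\<alpha>\<^sub>0 + \<Lambda>) (2 * m))"
      using M[OF basis_vec_mem[OF n(2)], of m "m + m"] n
      by (simp only: hnorm_basis_vec weight_1 mult_2)
    finally show ?thesis .
  qed
  (* 1 is added to keep the denominator positive *)
  define d where "d = (cmod (\<mu> 0 1))\<^sup>2 / (M\<^sup>2 + 1)"
  have d: "d > 0" using \<mu>_01 by (simp add: d_def add_nonneg_pos)
  have "d * (real m)\<^sup>2 * kernel_coeff \<alpha>\<^sub>0 (m + 1) \<le> kernel_coeff (\<alpha>\<^sub>0 + \<Lambda>) (2 * m)" for m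
  proof -
    have k: "0 \<le> kernel_coeff \<alpha>\<^sub>0 (m + 1)" "0 \<le> kernel_coeff (\<alpha>\<^sub>0 + \<Lambda>) (2 * m)"
      using \<alpha>\<^sub>0_pos \<Lambda>_pos by auto
    have "(cmod (\<mu> 0 1) * real m * sqrt (kernel_coeff \<alpha>\<^sub>0 (m + 1)))\<^sup>2
        \<le> (M * sqrt (kernel_coeff (\<alpha>\<^sub>0 + \<Lambda>) (2 * m)))\<^sup>2"
      using k by (intro power_mono le) auto
    then have "(cmod (\<mu> 0 1))\<^sup>2 * (real m)\<^sup>2 * kernel_coeff \<alpha>\<^sub>0 (m + 1)
        \<le> M\<^sup>2 * kernel_coeff (\<alpha>\<^sub>0 + \<Lambda>) (2 * m)"
      using k by (simp add: power_mult_distrib)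
    also have "\<dots> \<le> (M\<^sup>2 + 1) * kernel_coeff (\<alpha>\<^sub>0 + \<Lambda>) (2 * m)"
      using k by (intro mult_right_mono) auto
    finally show ?thesis
      by (simp add: d_def divide_le_eq add_nonneg_pos mult_ac)
  qed
  then show ?thesis
    by (rule two_le_if_kernel_coeff_comparison[OF \<alpha>\<^sub>0_pos \<Lambda>_pos d])
qed

end

end

section \<open>Reduction to a direct sum of weighted backward shifts\<close>

text \<open>
  The identity plus \<open>strict_upper\<close> is the operator that carries \<open>basis_vec j k\<close> to
  \<open>frame_coeff j k\<close>, that is, each atom \<open>embed j (atom (weight j) w)\<close> to
  \<open>frame weight \<mu> j w\<close>. Once it is known to be bounded, it conjugates \<open>T\<close> to the
  operator \<open>shift_sum\<close> that acts on atoms as multiplication by \<open>w\<close>.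
\<close>

context quasi_homogeneous_model
begin

context
  assumes weight_ge: "1 \<le> \<alpha>\<^sub>0" and valency_ge: "2 \<le> \<Lambda>"
begin

lemma one_le_weights: "1 \<le> weight i"
  using weight_ge \<Lambda>_pos by (simp add: weight_def add_increasing2)

lemma derivative_shift_exists:
  assumes "i < j" "j < n"
  shows "\<exists>Y. bounded_op (\<H> j) (\<H> i) Y \<and> (\<forall>k. Y (basis_fn (weight j) k) =
    complex_of_real (pochhammer (real k + 1) (j - i)) *\<^sub>C basis_fn (weight i) (k + (j - i)))"
proof -
  have "weight j = weight i + real (j - i) * \<Lambda>"
    using assms by (simp add: weight_def of_nat_diff algebra_simps)
  moreover have "real (j - i) * 2 \<le> real (j - i) * \<Lambda>"
    using valency_ge by (intro mult_left_mono) auto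
  ultimately have wt: "weight i + 2 * real (j - i) \<le> weight j" by simp
  obtain C where C: "0 \<le> C" and le: "\<And>k. (pochhammer (real k + 1) (j - i))\<^sup>2 *
      kernel_coeff (weight i) (k + (j - i)) \<le> C\<^sup>2 * kernel_coeff (weight j) k"
    by (rule derivative_shift_bound[OF one_le_weights wt], rule that)
  have ij: "j < n" "i < n" using assms by auto
  obtain Y where "bounded_op (\<H> j) (\<H> i) Y"
      and "\<And>k. Y (basis_fn (weight j) k) =
        complex_of_real (pochhammer (real k + 1) (j - i)) *\<^sub>C basis_fn (weight i) (k + (j - i))"
    by (rule weighted_forward_shift[where b = "\<lambda>k. pochhammer (real k + 1) (j - i)",
          OF bergman[OF ij(1)] bergman[OF ij(2)] C le], rule that)
  then show ?thesis by blast
qed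

text \<open>
  The operator that takes each atom of the summand \<open>j\<close> to the derivative of order \<open>j - i\<close> of the
  atom of the summand \<open>i\<close> at the same point.
\<close>

definition derivative_shift :: "nat \<Rightarrow> nat \<Rightarrow> (complex \<Rightarrow> complex) \<Rightarrow> complex \<Rightarrow> complex" where
  "derivative_shift i j = (SOME Y. bounded_op (\<H> j) (\<H> i) Y \<and> (\<forall>k. Y (basis_fn (weight j) k) =
    complex_of_real (pochhammer (real k + 1) (j - i)) *\<^sub>C basis_fn (weight i) (k + (j - i))))"

lemma derivative_shift:
  assumes "i < j" "j < n"
  shows "bounded_op (\<H> j) (\<H> i) (derivative_shift i j)"
    and "derivative_shift i j (basis_fn (weight j) k) =
      complex_of_real (pochhammer (real k + 1) (j - i)) *\<^sub>C basis_fn (weight i) (k + (j - i))"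
  using someI_ex[OF derivative_shift_exists[OF assms]] unfolding derivative_shift_def by blast+

definition strict_upper :: "(nat \<Rightarrow> complex \<Rightarrow> complex) \<Rightarrow> nat \<Rightarrow> complex \<Rightarrow> complex" where
  "strict_upper f = (\<Sum>i<n. embed i (\<Sum>j\<in>{i<..<n}. \<mu> i j *\<^sub>C derivative_shift i j (f j)))"

lemma bounded_op_strict_upper: "bounded_op DS DS strict_upper"
  unfolding strict_upper_def[abs_def]
proof (rule bounded_op_sum[OF _ inner_space_DS inner_space_DS])
  fix i assume "i \<in> {..<n}"
  then have i: "i < n" by simp
  have "bounded_op DS (\<H> i) (\<lambda>f. \<mu> i j *\<^sub>C derivative_shift i j (f j))" if "j \<in> {i<..<n}" for j
    using that inner_space_\<H> i
    by (intro bounded_op_scale bounded_op_compose[OF bounded_op_component derivative_shift(1)]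
        inner_space_DS) auto
  then have "bounded_op DS (\<H> i) (\<lambda>f. \<Sum>j\<in>{i<..<n}. \<mu> i j *\<^sub>C derivative_shift i j (f j))"
    by (rule bounded_op_sum[OF _ inner_space_DS inner_space_\<H>[OF i]])
  then show "bounded_op DS DS
      (\<lambda>f. embed i (\<Sum>j\<in>{i<..<n}. \<mu> i j *\<^sub>C derivative_shift i j (f j)))"
    by (rule bounded_op_compose[OF _ bounded_op_embed[OF i] inner_space_DS inner_space_\<H>[OF i]])
qed

text \<open>
  The component \<open>i\<close> of \<open>strict_upper f\<close> depends only on the components of \<open>f\<close> of larger index,
  so each application kills one more component, beginning with the last.
\<close>

lemma strict_upper_nilpotent:
  assumes f: "f \<in> carr DS"
  shows "(strict_upper ^^ n) f = 0"
proof -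
  have zero: "derivative_shift i j 0 = 0" if "i < j" "j < n" for i j
    using linear_op_zero[OF bounded_op_linear[OF derivative_shift(1)[OF that]] inner_space_\<H>] that
    by simp
  have "(strict_upper ^^ l) f i = 0" if "n \<le> i + l" for l i
    using that
  proof (induction l arbitrary: i)
    case 0
    then show ?case using f by (simp add: mem_iff)
  next
    case (Suc l)
    have inner: "(\<Sum>j\<in>{i<..<n}. \<mu> i j *\<^sub>C derivative_shift i j ((strict_upper ^^ l) f j)) = 0"
    proof (rule sum.neutral, rule ballI)
      fix j assume j: "j \<in> {i<..<n}"
      then have "n \<le> j + l" using Suc.prems by simp
      then show "\<mu> i j *\<^sub>C derivative_shift i j ((strict_upper ^^ l) f j) = 0"
        using j by (simp only: Suc.IH zero greaterThanLessThan_iff complex_vector.scale_zero_right)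
    qed
    have "(strict_upper ^^ Suc l) f i = (\<Sum>p<n. if i = p then
        \<Sum>j\<in>{p<..<n}. \<mu> p j *\<^sub>C derivative_shift p j ((strict_upper ^^ l) f j) else 0)"
      by (simp only: funpow.simps o_apply strict_upper_def sum_fun_apply embed_apply)
    also have "\<dots> = 0"
    proof (rule sum.neutral, rule ballI)
      fix p
      show "(if i = p then \<Sum>j\<in>{p<..<n}. \<mu> p j *\<^sub>C derivative_shift p j ((strict_upper ^^ l) f j) else 0) = 0"
        using inner by (cases "i = p") (simp_all only: if_cancel if_False)
    qed
    finally show ?case .
  qed
  then show ?thesis by (intro ext) (simp add: zero_fun_def)
qed

lemma strict_upper_basis_vec:
  assumes j: "j < n"
  shows "basis_vec j k + strict_upper (basis_vec j k) = frame_coeff j k"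
proof -
  let ?t = "\<lambda>i. (\<mu> i j * of_real (pochhammer (real k + 1) (j - i))) *\<^sub>C basis_vec i (k + (j - i))"
  have zero: "derivative_shift i l 0 = 0" if "i < l" "l < n" for i l
    using linear_op_zero[OF bounded_op_linear[OF derivative_shift(1)[OF that]] inner_space_\<H>] that
    by simp
  have "embed i (\<Sum>l\<in>{i<..<n}. \<mu> i l *\<^sub>C derivative_shift i l (basis_vec j k l)) = (if i < j then ?t i else 0)" for i
  proof -
    have "(\<Sum>l\<in>{i<..<n}. \<mu> i l *\<^sub>C derivative_shift i l (basis_vec j k l)) =
      (\<Sum>l\<in>{i<..<n}. if l = j then \<mu> i j *\<^sub>C derivative_shift i j (basis_fn (weight j) k) else 0)"
      by (intro sum.cong refl) (auto simp: basis_vec_def embed_apply zero)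
    also have "\<dots> = (if i < j then \<mu> i j *\<^sub>C derivative_shift i j (basis_fn (weight j) k) else 0)"
      using j by (simp add: sum.delta)
    finally show ?thesis
      using j by (simp add: derivative_shift(2) basis_vec_def embed_scale scaleC_scaleC)
  qed
  then have "strict_upper (basis_vec j k) = (\<Sum>i<n. if i < j then ?t i else 0)"
    by (simp only: strict_upper_def)
  also have "\<dots> = (\<Sum>i\<in>{..<n} \<inter> {..<j}. ?t i)"
    by (simp only: sum.inter_restrict[OF finite_lessThan] lessThan_iff)
  also have "{..<n} \<inter> {..<j} = {..<j}" using j by auto
  finally show ?thesis
    using \<mu>_diag[OF j]
    by (simp add: frame_coeff_def lessThan_Suc_atMost[symmetric] scaleC_one add.commute)
qed

lemma backward_shift_exists:
  assumes "i < n"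
  shows "\<exists>B. bounded_op (\<H> i) (\<H> i) B \<and> (\<forall>f\<in>carr (\<H> i). hnorm (\<H> i) (B f) \<le> hnorm (\<H> i) f) \<and>
    (\<forall>k. B (basis_fn (weight i) k) = (case k of 0 \<Rightarrow> 0 | Suc l \<Rightarrow> basis_fn (weight i) l))"
proof -
  obtain B where B: "bounded_op (\<H> i) (\<H> i) B" "\<And>f. f \<in> carr (\<H> i) \<Longrightarrow> hnorm (\<H> i) (B f) \<le> hnorm (\<H> i) f"
      "B (basis_fn (weight i) 0) = 0" "\<And>k. B (basis_fn (weight i) (Suc k)) = basis_fn (weight i) k"
    by (rule contractive_backward_shift[OF bergman[OF assms] one_le_weights]) (rule that)
  have "B (basis_fn (weight i) k) = (case k of 0 \<Rightarrow> 0 | Suc l \<Rightarrow> basis_fn (weight i) l)" for k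
    by (cases k) (simp_all only: B(3,4) nat.case)
  then show ?thesis using B(1,2) by blast
qed

definition backward_shift :: "nat \<Rightarrow> (complex \<Rightarrow> complex) \<Rightarrow> complex \<Rightarrow> complex" where
  "backward_shift i = (SOME B. bounded_op (\<H> i) (\<H> i) B \<and>
    (\<forall>f\<in>carr (\<H> i). hnorm (\<H> i) (B f) \<le> hnorm (\<H> i) f) \<and>
    (\<forall>k. B (basis_fn (weight i) k) = (case k of 0 \<Rightarrow> 0 | Suc l \<Rightarrow> basis_fn (weight i) l)))"

lemma backward_shift:
  assumes "i < n"
  shows "bounded_op (\<H> i) (\<H> i) (backward_shift i)"
    and "f \<in> carr (\<H> i) \<Longrightarrow> hnorm (\<H> i) (backward_shift i f) \<le> hnorm (\<H> i) f"
    and "backward_shift i (basis_fn (weight i) k) = (case k of 0 \<Rightarrow> 0 | Suc l \<Rightarrow> basis_fn (weight i) l)"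
  using someI_ex[OF backward_shift_exists[OF assms]] unfolding backward_shift_def by blast+

definition shift_sum :: "(nat \<Rightarrow> complex \<Rightarrow> complex) \<Rightarrow> nat \<Rightarrow> complex \<Rightarrow> complex" where
  "shift_sum f = (\<Sum>i<n. embed i (backward_shift i (f i)))"

lemma bounded_op_shift_sum: "bounded_op DS DS shift_sum"
  unfolding shift_sum_def[abs_def]
  by (intro bounded_op_sum inner_space_DS inner_space_\<H>
      bounded_op_compose[OF bounded_op_compose[OF bounded_op_component backward_shift(1)] bounded_op_embed])
    auto

lemma shift_sum_component:
  assumes "i < n"
  shows "shift_sum f i = backward_shift i (f i)"
proof -
  have "shift_sum f i = (\<Sum>l<n. if i = l then backward_shift l (f l) else 0)"
    by (simp only: shift_sum_def sum_fun_apply embed_apply)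
  also have "\<dots> = backward_shift i (f i)" using assms by simp
  finally show ?thesis .
qed

lemma shift_sum_contraction:
  assumes f: "f \<in> carr DS"
  shows "hnorm DS (shift_sum f) \<le> hnorm DS f"
proof -
  have m: "shift_sum f \<in> carr DS"
    using linear_opD(1)[OF bounded_op_linear[OF bounded_op_shift_sum] f] .
  have "(hnorm (\<H> i) (shift_sum f i))\<^sup>2 \<le> (hnorm (\<H> i) (f i))\<^sup>2" if "i < n" for i
  proof (rule power_mono)
    show "hnorm (\<H> i) (shift_sum f i) \<le> hnorm (\<H> i) (f i)"
      using f that by (simp only: shift_sum_component) (intro backward_shift(2); simp add: mem_iff)
    show "0 \<le> hnorm (\<H> i) (shift_sum f i)"
      using m that inner_space.hnorm_nonneg[OF summand] by (simp add: mem_iff)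
  qed
  then have "(hnorm DS (shift_sum f))\<^sup>2 \<le> (hnorm DS f)\<^sup>2"
    unfolding hnorm_DS_power2[OF m] hnorm_DS_power2[OF f] by (intro sum_mono) simp
  then show ?thesis by (rule power2_le_imp_le) (use f in simp)
qed

lemma shift_sum_basis_vec:
  assumes j: "j < n"
  shows "shift_sum (basis_vec j k) = (case k of 0 \<Rightarrow> 0 | Suc l \<Rightarrow> basis_vec j l)"
proof -
  have zero: "backward_shift i 0 = 0" if "i < n" for i
    using linear_op_zero[OF bounded_op_linear[OF backward_shift(1)[OF that]] inner_space_\<H>[OF that]] .
  have "shift_sum (basis_vec j k) = (\<Sum>i<n. if i = j then embed j (backward_shift j (basis_fn (weight j) k)) else 0)"
    unfolding shift_sum_def
    by (intro sum.cong refl) (auto simp: basis_vec_def embed_apply zero)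
  also have "\<dots> = embed j (backward_shift j (basis_fn (weight j) k))" using j by simp
  finally show ?thesis
    by (cases k) (simp_all add: backward_shift(3)[OF j] basis_vec_def)
qed

text \<open>
  Both sides are bounded operators in \<open>f\<close>, so it suffices to compare them on the vectors
  \<open>basis_vec j k\<close>, where the claim is that \<open>T\<close> maps \<open>frame_coeff j k\<close> to its predecessor.
\<close>

lemma intertwining:
  assumes f: "f \<in> carr DS"
  shows "T (f + strict_upper f) = shift_sum f + strict_upper (shift_sum f)"
proof -
  define X where "X = (\<lambda>f. f + strict_upper f)"
  have X: "bounded_op DS DS X"
    unfolding X_def
    by (intro bounded_op_add bounded_op_ident bounded_op_strict_upper inner_space_DS)
  have X_vec: "X (basis_vec j k) = frame_coeff j k" if "j < n" for j k
    unfolding X_def by (rule strict_upper_basis_vec[OF that])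
  have TX: "bounded_op DS DS (\<lambda>f. T (X f))"
    by (rule bounded_op_compose[OF X T_bounded inner_space_DS inner_space_DS])
  have XB: "bounded_op DS DS (\<lambda>f. X (shift_sum f))"
    by (rule bounded_op_compose[OF bounded_op_shift_sum X inner_space_DS inner_space_DS])
  have comp: "T (X (embed j h)) = X (shift_sum (embed j h))" if j: "j < n" and h: "h \<in> carr (\<H> j)" for j h
  proof (rule weighted_bergman.bounded_ops_eqI[OF bergman[OF j] _ _ inner_space_DS _ h])
    show "bounded_op (\<H> j) DS (\<lambda>h. T (X (embed j h)))"
      by (rule bounded_op_compose[OF bounded_op_embed[OF j] TX inner_space_\<H>[OF j] inner_space_DS])
    show "bounded_op (\<H> j) DS (\<lambda>h. X (shift_sum (embed j h)))"
      by (rule bounded_op_compose[OF bounded_op_embed[OF j] XB inner_space_\<H>[OF j] inner_space_DS])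
    fix k
    have "X 0 = 0" by (rule linear_op_zero[OF bounded_op_linear[OF X] inner_space_DS])
    then have "T (X (basis_vec j k)) = X (shift_sum (basis_vec j k))"
      unfolding X_vec[OF j] T_frame_coeff[OF j] shift_sum_basis_vec[OF j]
      by (cases k) (simp_all only: nat.case X_vec[OF j])
    then show "T (X (embed j (basis_fn (weight j) k))) = X (shift_sum (embed j (basis_fn (weight j) k)))"
      by (simp only: basis_vec_def)
  qed
  have mem: "embed j (f j) \<in> carr DS" if "j \<in> {..<n}" for j
    using f that by (intro embed_mem) (auto simp: mem_iff)
  have "T (X (\<Sum>j<n. embed j (f j))) = (\<Sum>j<n. T (X (embed j (f j))))"
    by (rule linear_op_sum[OF bounded_op_linear[OF TX] inner_space_DS mem])
  also have "\<dots> = (\<Sum>j<n. X (shift_sum (embed j (f j))))"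
    using f by (intro sum.cong refl comp) (auto simp: mem_iff)
  also have "\<dots> = X (shift_sum (\<Sum>j<n. embed j (f j)))"
    by (rule linear_op_sum[OF bounded_op_linear[OF XB] inner_space_DS mem, symmetric])
  finally have "T (X f) = X (shift_sum f)" by (simp only: eq_sum_embed[OF f, symmetric])
  then show ?thesis by (simp only: X_def)
qed

lemma similar_to_shift_sum:
  obtains L L' where "bounded_op DS DS L" "bounded_op DS DS L'"
    and "\<And>x. x \<in> carr DS \<Longrightarrow> L' (L x) = x" "\<And>x. x \<in> carr DS \<Longrightarrow> L (L' x) = x"
    and "\<And>x. x \<in> carr DS \<Longrightarrow> T x = L (shift_sum (L' x))"
proof -
  obtain L' where L': "bounded_op DS DS L'"
    and inv: "\<And>x. x \<in> carr DS \<Longrightarrow> L' (x + strict_upper x) = x \<and> L' x + strict_upper (L' x) = x"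
    by (rule nilpotent_perturbation_invertible[OF bounded_op_strict_upper inner_space_DS
          strict_upper_nilpotent], assumption, rule that)
  define L where "L = (\<lambda>x. x + strict_upper x)"
  have L: "bounded_op DS DS L"
    unfolding L_def
    by (intro bounded_op_add bounded_op_ident bounded_op_strict_upper inner_space_DS)
  have LL': "L (L' x) = x" if "x \<in> carr DS" for x using inv[OF that] by (simp add: L_def)
  have "T x = L (shift_sum (L' x))" if x: "x \<in> carr DS" for x
  proof -
    have "L' x \<in> carr DS" using linear_opD(1)[OF bounded_op_linear[OF L'] x] .
    then have "T (L (L' x)) = L (shift_sum (L' x))" unfolding L_def by (rule intertwining)
    then show ?thesis by (simp only: LL'[OF x])
  qed
  then show ?thesis using that[OF L L'] LL' inv by (simp add: L_def)
qed

end

end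

section \<open>Unitary equivalence and the theorem\<close>

lemma op_norm_le_1I:
  assumes "inner_space H" "\<And>x. x \<in> carr H \<Longrightarrow> hnorm H (C x) \<le> hnorm H x"
  shows "op_norm H C \<le> 1"
proof -
  interpret inner_space H by fact
  show ?thesis
    unfolding op_norm_def
  proof (rule cSUP_least)
    have "0 \<in> {x \<in> carr H. hnorm H x \<le> 1}" by simp
    then show "{x \<in> carr H. hnorm H x \<le> 1} \<noteq> {}" by blast
    show "hnorm H (C x) \<le> 1" if "x \<in> {x \<in> carr H. hnorm H x \<le> 1}" for x
      using that assms(2)[of x] by auto
  qed
qed

lemma hnorm_le_op_norm:
  assumes A: "bounded_op H H A" and H: "inner_space H" and x: "x \<in> carr H"
  shows "hnorm H (A x) \<le> op_norm H A * hnorm H x"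
proof (cases "x = 0")
  case True
  interpret inner_space H by fact
  show ?thesis using True linear_op_zero[OF bounded_op_linear[OF A] H] by simp
next
  case False
  interpret inner_space H by fact
  obtain B where B: "B \<ge> 0" "\<And>x. x \<in> carr H \<Longrightarrow> hnorm H (A x) \<le> B * hnorm H x"
    by (rule bounded_op_bound[OF A H], rule that)
  have pos: "hnorm H x > 0" using False x hnorm_eq_0_iff[OF x] hnorm_nonneg[OF x] by linarith
  define c where "c = complex_of_real (1 / hnorm H x)"
  have c: "cmod c = 1 / hnorm H x" using pos by (simp only: c_def norm_of_real) simp
  have "bdd_above ((\<lambda>x. hnorm H (A x)) ` {x \<in> carr H. hnorm H x \<le> 1})"
  proof (rule bdd_aboveI2)
    fix y assume y: "y \<in> {x \<in> carr H. hnorm H x \<le> 1}"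
    then have "B * hnorm H y \<le> B * 1" using B(1) by (intro mult_left_mono) auto
    then show "hnorm H (A y) \<le> B" using B(2)[of y] y by simp
  qed
  moreover have "c *\<^sub>C x \<in> {x \<in> carr H. hnorm H x \<le> 1}"
    using x pos by (simp add: hnorm_scale c)
  ultimately have "hnorm H (A (c *\<^sub>C x)) \<le> op_norm H A"
    unfolding op_norm_def by (rule cSUP_upper[rotated])
  also have "hnorm H (A (c *\<^sub>C x)) = 1 / hnorm H x * hnorm H (A x)"
    using x linear_opD[OF bounded_op_linear[OF A]] by (simp add: hnorm_scale c)
  finally show ?thesis using pos by (simp add: field_simps)
qed

lemma unitary_hnorm:
  "unitary H K U \<Longrightarrow> x \<in> carr H \<Longrightarrow> hnorm K (U x) = hnorm H x"
  by (simp add: unitary_def hnorm_def)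

lemma unitary_bounded: "unitary H K U \<Longrightarrow> bounded_op H K U"
  using unitary_hnorm[of H K U] by (auto simp: bounded_op_def unitary_def intro!: exI[of _ 1])

lemma unitary_inverse:
  assumes U: "unitary H K U" and H: "inner_space H"
  obtains V where "unitary K H V" "\<And>x. x \<in> carr H \<Longrightarrow> V (U x) = x" "\<And>y. y \<in> carr K \<Longrightarrow> U (V y) = y"
proof -
  interpret inner_space H by fact
  have lin: "linear_op H K U" and bij: "bij_betw U (carr H) (carr K)"
    and iso: "\<And>x y. x \<in> carr H \<Longrightarrow> y \<in> carr H \<Longrightarrow> ip K (U x) (U y) = ip H x y"
    using U by (auto simp: unitary_def)
  define V where "V = inv_into (carr H) U"
  have VU: "V (U x) = x" if "x \<in> carr H" for x
    using bij that by (simp add: V_def bij_betw_def inv_into_f_f)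
  have UV: "U (V y) = y" and V_mem: "V y \<in> carr H" if "y \<in> carr K" for y
    using bij that by (auto simp: V_def bij_betw_def f_inv_into_f inv_into_into)
  have "V (x + y) = V x + V y" if "x \<in> carr K" "y \<in> carr K" for x y
    using VU[of "V x + V y"] linear_opD(2)[OF lin V_mem V_mem] that UV V_mem by simp
  moreover have "V (c *\<^sub>C x) = c *\<^sub>C V x" if "x \<in> carr K" for c x
    using VU[of "c *\<^sub>C V x"] linear_opD(3)[OF lin V_mem] that UV V_mem by simp
  ultimately have "linear_op K H V" using V_mem by (auto simp: linear_op_def)
  moreover have "bij_betw V (carr K) (carr H)" unfolding V_def by (rule bij_betw_inv_into[OF bij])
  moreover have "ip H (V x) (V y) = ip K x y" if "x \<in> carr K" "y \<in> carr K" for x y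
    using iso[OF V_mem V_mem] that UV by simp
  ultimately have "unitary K H V" by (auto simp: unitary_def)
  then show ?thesis using VU UV by (rule that)
qed

lemma similar_to_contraction_if_unitarily_equivalent:
  assumes H: "inner_space H" and K: "inner_space K"
    and eq: "unitarily_equivalent H S K T"
    and L: "bounded_op K K L" and L': "bounded_op K K L'" and C: "bounded_op K K C"
    and inv: "\<And>x. x \<in> carr K \<Longrightarrow> L' (L x) = x" "\<And>x. x \<in> carr K \<Longrightarrow> L (L' x) = x"
    and contr: "\<And>x. x \<in> carr K \<Longrightarrow> hnorm K (C x) \<le> hnorm K x"
    and T: "\<And>x. x \<in> carr K \<Longrightarrow> T x = L (C (L' x))"
    and S: "\<And>x. x \<in> carr H \<Longrightarrow> S x \<in> carr H"
  shows "similar_to_contraction H S"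
proof -
  obtain U where U: "unitary H K U" and US: "\<And>x. x \<in> carr H \<Longrightarrow> U (S x) = T (U x)"
    using eq by (auto simp: unitarily_equivalent_def)
  obtain V where V: "unitary K H V" and VU: "\<And>x. x \<in> carr H \<Longrightarrow> V (U x) = x"
    and UV: "\<And>y. y \<in> carr K \<Longrightarrow> U (V y) = y"
    by (rule unitary_inverse[OF U H], rule that)
  note bU = unitary_bounded[OF U] and bV = unitary_bounded[OF V]
  note mem = linear_opD(1)[OF bounded_op_linear[OF bU]] linear_opD(1)[OF bounded_op_linear[OF bV]]
    linear_opD(1)[OF bounded_op_linear[OF L]] linear_opD(1)[OF bounded_op_linear[OF L']]
    linear_opD(1)[OF bounded_op_linear[OF C]]
  have conj: "bounded_op H H (\<lambda>x. V (A (U x)))" if "bounded_op K K A" for A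
    by (rule bounded_op_compose[OF bounded_op_compose[OF bU that H K] bV H K])
  show ?thesis
    unfolding similar_to_contraction_def
  proof (intro exI conjI ballI)
    show "bounded_op H H (\<lambda>x. V (L (U x)))" "bounded_op H H (\<lambda>x. V (L' (U x)))"
      "bounded_op H H (\<lambda>x. V (C (U x)))"
      using L L' C by (blast intro: conj)+
    fix x assume x: "x \<in> carr H"
    show "V (L' (U (V (L (U x))))) = x" "V (L (U (V (L' (U x))))) = x"
      using x by (simp_all add: mem UV VU inv)
    have "S x = V (T (U x))" using x VU[OF S[OF x]] US[OF x] by simp
    then show "S x = V (L (U (V (C (U (V (L' (U x)))))))) "
      using x by (simp add: mem UV T)
  next
    show "op_norm H (\<lambda>x. V (C (U x))) \<le> 1"
    proof (rule op_norm_le_1I[OF H])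
      fix x assume x: "x \<in> carr H"
      have "hnorm H (V (C (U x))) = hnorm K (C (U x))"
        using x by (intro unitary_hnorm[OF V] mem)
      also have "\<dots> \<le> hnorm K (U x)" using x by (intro contr mem)
      also have "\<dots> = hnorm H x" by (rule unitary_hnorm[OF U x])
      finally show "hnorm H (V (C (U x))) \<le> hnorm H x" .
    qed
  qed
qed

lemma poly_op_monom: "poly_op (monom 1 m) T x = (T ^^ m) x"
proof -
  have "poly_op (monom 1 m) T x = (\<Sum>k\<le>m. if k = m then (T ^^ m) x else 0)"
    unfolding poly_op_def degree_monom_eq[OF one_neq_zero]
    by (intro sum.cong refl) (auto simp: scaleC_one)
  then show ?thesis by simp
qed

lemma disc_norm_monom_le: "disc_norm (monom 1 m) \<le> 1"
  unfolding disc_norm_def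
  by (rule cSUP_least) (auto simp: poly_monom norm_power power_le_one)

lemma disc_norm_monom_nonneg: "0 \<le> disc_norm (monom 1 m)"
proof -
  have "bdd_above ((\<lambda>z. cmod (poly (monom 1 m) z)) ` ball 0 1)"
    by (intro bdd_aboveI2[of _ _ 1]) (auto simp: poly_monom norm_power power_le_one)
  then have "cmod (poly (monom 1 m) 0) \<le> disc_norm (monom 1 m)"
    unfolding disc_norm_def by (intro cSUP_upper) auto
  then show ?thesis using norm_ge_zero order.trans by blast
qed

text \<open>
  Only the monomials, which are bounded by 1 on the disc, are tested. The absolute value of \<open>K\<close>
  makes the right side monotone in \<open>disc_norm\<close>.
\<close>

lemma polynomially_bounded_imp_power_bounded:
  assumes S: "bounded_op H H S" and H: "inner_space H"
    and K: "\<And>p :: complex poly. op_norm H (poly_op p S) \<le> K * disc_norm p"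
    and x: "x \<in> carr H"
  shows "hnorm H ((S ^^ m) x) \<le> \<bar>K\<bar> * hnorm H x"
proof -
  interpret inner_space H by fact
  have "op_norm H (S ^^ m) \<le> K * disc_norm (monom 1 m)"
    using K[of "monom 1 m"] by (simp add: poly_op_monom[abs_def])
  also have "\<dots> \<le> \<bar>K\<bar> * 1"
    by (intro mult_mono disc_norm_monom_le disc_norm_monom_nonneg) auto
  finally have "op_norm H (S ^^ m) * hnorm H x \<le> \<bar>K\<bar> * hnorm H x"
    using x by (intro mult_right_mono) auto
  then show ?thesis
    using hnorm_le_op_norm[OF bounded_op_power[OF S H] H x, of m] by linarith
qed

theorem theorem4p17:
  fixes H :: "'a::complex_vector hspace" and T :: "'a \<Rightarrow> 'a"
  assumes "quasi_homogeneous H T"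
    and "\<exists>K::real. \<forall>p :: complex poly. op_norm H (poly_op p T) \<le> K * disc_norm p"
  shows "similar_to_contraction H T"
proof -
  obtain K where K: "\<And>p :: complex poly. op_norm H (poly_op p T) \<le> K * disc_norm p"
    using assms(2) by blast
  have H: "inner_space H" and T: "bounded_op H H T"
    using assms(1) by (simp_all add: quasi_homogeneous_def hilbert_space_def inner_space_def)
  obtain n \<alpha>\<^sub>0 \<Lambda> \<mu> \<H> T' where model: "model_operator n \<alpha>\<^sub>0 \<Lambda> \<mu> \<H> T'"
    and eq: "unitarily_equivalent H T (direct_sum n \<H>) T'"
    using assms(1) unfolding quasi_homogeneous_def by blast
  interpret Q: quasi_homogeneous_model n \<alpha>\<^sub>0 \<Lambda> \<mu> \<H> T' by unfold_locales (rule model)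
  obtain U where U: "unitary H Q.DS U" and UT: "\<And>x. x \<in> carr H \<Longrightarrow> U (T x) = T' (U x)"
    using eq by (auto simp: unitarily_equivalent_def)
  have T_mem: "(T ^^ m) x \<in> carr H" if "x \<in> carr H" for m x
    using linear_opD(1)[OF bounded_op_linear[OF bounded_op_power[OF T H]] that] .
  have U_pow: "U ((T ^^ m) x) = (T' ^^ m) (U x)" if "x \<in> carr H" for m x
    by (induction m) (simp_all add: UT T_mem[OF that])
  have bound: "hnorm Q.DS ((T' ^^ m) f) \<le> \<bar>K\<bar> * hnorm Q.DS f" if "f \<in> carr Q.DS" for m f
  proof -
    have "bij_betw U (carr H) (carr Q.DS)" using U by (simp only: unitary_def)
    then have "f \<in> U ` carr H" using that by (simp only: bij_betw_imp_surj_on)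
    then obtain x where x: "x \<in> carr H" "f = U x" by (rule imageE)
    have "hnorm H ((T ^^ m) x) \<le> \<bar>K\<bar> * hnorm H x"
      by (rule polynomially_bounded_imp_power_bounded[OF T H K x(1)])
    then show ?thesis
      unfolding x(2) U_pow[OF x(1), symmetric] unitary_hnorm[OF U T_mem[OF x(1)]]
        unitary_hnorm[OF U x(1)] .
  qed
  have weight: "1 \<le> \<alpha>\<^sub>0" by (rule Q.one_le_weight[OF bound])
  have valency: "2 \<le> \<Lambda>" by (rule Q.two_le_valency[OF bound])
  show ?thesis
  proof (rule Q.similar_to_shift_sum[OF weight valency])
    fix L L'
    assume L: "bounded_op Q.DS Q.DS L" and L': "bounded_op Q.DS Q.DS L'"
      and inv: "\<And>x. x \<in> carr Q.DS \<Longrightarrow> L' (L x) = x" "\<And>x. x \<in> carr Q.DS \<Longrightarrow> L (L' x) = x"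
      and T': "\<And>x. x \<in> carr Q.DS \<Longrightarrow> T' x = L (Q.shift_sum (L' x))"
    show "similar_to_contraction H T"
    proof (rule similar_to_contraction_if_unitarily_equivalent[OF H Q.inner_space_DS eq L L'
          Q.bounded_op_shift_sum[OF weight valency]])
      fix x assume x: "x \<in> carr Q.DS"
      show "L' (L x) = x" by (rule inv(1)[OF x])
      show "L (L' x) = x" by (rule inv(2)[OF x])
      show "T' x = L (Q.shift_sum (L' x))" by (rule T'[OF x])
      show "hnorm Q.DS (Q.shift_sum x) \<le> hnorm Q.DS x"
        by (rule Q.shift_sum_contraction[OF weight valency x])
    next
      fix x assume "x \<in> carr H"
      then show "T x \<in> carr H" by (rule linear_opD(1)[OF bounded_op_linear[OF T]])
    qed
  qed
qed

end
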